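(* Let $d\ge 2$ and consider the annealed Ising model on the random $d$-regular (multi)graph with $n$ vertices. Suppose that $(\beta,B)\in\mathcal{U}$. Then for any $\varepsilon>0$ there exists a constant $L=L(\varepsilon)>0$ such that for all sufficiently large $n$, $$\mu_n\left(\left|\frac{S_n}{n}-\mathcal{M}(\beta,B)\right|>\varepsilon\right)\le\exp(-nL),$$ where $\mathcal{M}(\beta,B)=\lim_{n\to\infty}\mathbb{E}_{\mu_n}(S_n/n)=\frac{\partial}{\partial B}\psi(\beta,B)$.
   Context: Random $d$-regular graph $G_{n,d}$ (configuration model): attach $d$ half-edges to each of the vertices $v_1,\dots,v_n$ and pair all half-edges by a uniformly random perfect matching, each pair forming an edge; self-loops and multiple edges are allowed. The total number of half-edges is assumed even (if $dn$ is odd, the degree of one vertex is increased by $1$). Ising model: let $k_{i,j}$ be the number of edges between $v_i$ and $v_j$ (for $i=j$, the number of self-loops at $v_i$), $\beta\ge 0$, $B\in\mathbb{R}$, $\Omega_n=\{-1,1\}^n$. For $\sigma\in\Omega_n$ put $$H(\sigma)=-\beta\sum_{i\le j}k_{i,j}\sigma_i\sigma_j-B\sum_{i=1}^n\sigma_i,\qquad Z_n(\beta,B)=\sum_{\sigma\in\Omega_n}e^{-H(\sigma)}.$$ With $\mathbb{E}$ the expectation over the random graph, the annealed measure on $\Omega_n$ is $\mu_n(\sigma)=\mathbb{E}(e^{-H(\sigma)})/\mathbb{E}(Z_n(\beta,B))$; $S_n=\sigma_1+\dots+\sigma_n$. The limiting annealed pressure $\psi(\beta,B)=\lim_n\frac1n\log\mathbb{E}(Z_n(\beta,B))$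 is $$\psi(\beta,B)=\frac{\beta d}{2}-B+\max_{0\le t\le 1}\Big[(t-1)\log(1-t)-t\log t+2Bt+dF(t)\Big],$$ with $F(t)=\int_0^{\min\{t,1-t\}}\log f(s)\,ds$, $f(s)=\frac{e^{-2\beta}(1-2s)+\sqrt{1+(e^{-4\beta}-1)(1-2s)^2}}{2(1-s)}$, and $0\log 0=0$. The critical inverse temperature is $\beta_c=\inf\{\beta>0:\lim_{B\searrow 0}\mathcal{M}(\beta,B)>0\}$, which equals $\operatorname{atanh}(1/(d-1))$ (so $\frac12\log\frac{d}{d-2}$ if $d\ge3$ and $\infty$ if $d=2$), and $\mathcal{U}=\{(\beta,B):\ \beta\ge 0,\ B\ne 0,\ \text{ or }\ 0<\beta<\beta_c,\ B=0\}$. *)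

theory Defs
  imports "HOL-Probability.Probability"
begin

text \<open>
  The vertices $v_1,\dots,v_n$ are \<open>0, \<dots>, n - 1\<close>. If \<open>d * n\<close> is odd, the vertex whose
  degree is raised by one is vertex \<open>0\<close>; relabelling the vertices shows that the law of the
  total spin does not depend on this choice.
\<close>

definition vertex_degree :: "nat \<Rightarrow> nat \<Rightarrow> nat \<Rightarrow> nat" where
  "vertex_degree d n i = (if odd (d * n) \<and> i = 0 then d + 1 else d)"

text \<open>The pair \<open>(i, h)\<close> is the \<open>h\<close>-th half-edge attached to vertex \<open>i\<close>.\<close>

definition half_edges :: "nat \<Rightarrow> nat \<Rightarrow> (nat \<times> nat) set" where
  "half_edges d n = (SIGMA i:{..<n}. {..<vertex_degree d n i})"

definition perfect_matchings :: "'a set \<Rightarrow> 'a set set set" where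
  "perfect_matchings H = {P. partition_on H P \<and> (\<forall>e\<in>P. card e = 2)}"

definition configuration_model :: "nat \<Rightarrow> nat \<Rightarrow> (nat \<times> nat) set set pmf" where
  "configuration_model d n = pmf_of_set (perfect_matchings (half_edges d n))"

text \<open>
  The number $k_{i,j}$ of edges between \<open>i\<close> and \<open>j\<close>; for \<open>i = j\<close> this counts the pairs
  consisting of two half-edges of \<open>i\<close>, that is, the self-loops at \<open>i\<close>.
\<close>

definition edge_count :: "(nat \<times> nat) set set \<Rightarrow> nat \<Rightarrow> nat \<Rightarrow> nat" where
  "edge_count P i j = card {e \<in> P. fst ` e = {i, j}}"

definition spin_configs :: "nat \<Rightarrow> (nat \<Rightarrow> real) set" where
  "spin_configs n = {..<n} \<rightarrow>\<^sub>E {-1, 1}"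

definition total_spin :: "nat \<Rightarrow> (nat \<Rightarrow> real) \<Rightarrow> real" where
  "total_spin n \<sigma> = (\<Sum>i<n. \<sigma> i)"

definition hamiltonian ::
    "nat \<Rightarrow> real \<Rightarrow> real \<Rightarrow> (nat \<times> nat) set set \<Rightarrow> (nat \<Rightarrow> real) \<Rightarrow> real" where
  "hamiltonian n \<beta> B P \<sigma> =
     - \<beta> * (\<Sum>i<n. \<Sum>j\<in>{i..<n}. real (edge_count P i j) * \<sigma> i * \<sigma> j) - B * (\<Sum>i<n. \<sigma> i)"

definition partition_function :: "nat \<Rightarrow> real \<Rightarrow> real \<Rightarrow> (nat \<times> nat) set set \<Rightarrow> real" where
  "partition_function n \<beta> B P = (\<Sum>\<sigma>\<in>spin_configs n. exp (- hamiltonian n \<beta> B P \<sigma>))"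

definition annealed_partition_function :: "nat \<Rightarrow> nat \<Rightarrow> real \<Rightarrow> real \<Rightarrow> real" where
  "annealed_partition_function d n \<beta> B =
     measure_pmf.expectation (configuration_model d n) (partition_function n \<beta> B)"

definition annealed_measure :: "nat \<Rightarrow> nat \<Rightarrow> real \<Rightarrow> real \<Rightarrow> (nat \<Rightarrow> real) measure" where
  "annealed_measure d n \<beta> B = point_measure (spin_configs n) (\<lambda>\<sigma>. ennreal
     (measure_pmf.expectation (configuration_model d n) (\<lambda>P. exp (- hamiltonian n \<beta> B P \<sigma>))
        / annealed_partition_function d n \<beta> B))"

definition pressure :: "nat \<Rightarrow> real \<Rightarrow> real \<Rightarrow> real" where
  "pressure d \<beta> B = lim (\<lambda>n. ln (annealed_partition_function d n \<beta> B) / real n)"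

definition finite_magnetization :: "nat \<Rightarrow> nat \<Rightarrow> real \<Rightarrow> real \<Rightarrow> real" where
  "finite_magnetization d n \<beta> B = (\<integral>\<sigma>. total_spin n \<sigma> / real n \<partial>annealed_measure d n \<beta> B)"

definition magnetization :: "nat \<Rightarrow> real \<Rightarrow> real \<Rightarrow> real" where
  "magnetization d \<beta> B = lim (\<lambda>n. finite_magnetization d n \<beta> B)"

text \<open>Taken in the extended reals, so that it is \<open>\<infinity>\<close> if the magnetization never persists.\<close>

definition critical_beta :: "nat \<Rightarrow> ereal" where
  "critical_beta d =
     (INF \<beta>\<in>{\<beta>. \<beta> > 0 \<and> (\<exists>m>0. (magnetization d \<beta> \<longlongrightarrow> m) (at_right 0))}. ereal \<beta>)"

definition uniqueness_region :: "nat \<Rightarrow> (real \<times> real) set" where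
  "uniqueness_region d =
     {(\<beta>, B). (\<beta> \<ge> 0 \<and> B \<noteq> 0) \<or> (0 < \<beta> \<and> ereal \<beta> < critical_beta d \<and> B = 0)}"

lemma perfect_matchings_nonempty:
  assumes "finite H" "even (card H)"
  shows "perfect_matchings H \<noteq> {}"
  using assms
proof (induction "card H" arbitrary: H rule: less_induct)
  case less
  show ?case
  proof (cases "H = {}")
    case True
    then have "{} \<in> perfect_matchings H"
      by (auto simp: perfect_matchings_def partition_on_def)
    then show ?thesis by blast
  next
    case False
    then obtain x where x: "x \<in> H" by blast
    have "card H \<noteq> 1" using less.prems by auto
    then have "H \<noteq> {x}" by auto
    then obtain y where y: "y \<in> H" "y \<noteq> x" using x by blast
    have e: "card {x, y} = 2" using y by simp
    have c: "card (H - {x, y}) = card H - 2"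
      using x y less.prems e by (subst card_Diff_subset) auto
    have "card H > 0" using x less.prems card_gt_0_iff by blast
    then have "perfect_matchings (H - {x, y}) \<noteq> {}"
      using less.hyps[of "H - {x, y}"] less.prems c by auto
    then obtain P where P: "partition_on (H - {x, y}) P" "\<forall>e\<in>P. card e = 2"
      by (auto simp: perfect_matchings_def)
    have "partition_on H (insert {x, y} P)"
      using P(1) x y by (subst partition_on_insert) (auto simp: partition_on_def disjoint_def disjnt_def)
    then have "insert {x, y} P \<in> perfect_matchings H"
      using P(2) e by (auto simp: perfect_matchings_def)
    then show ?thesis by blast
  qed
qed

lemma finite_perfect_matchings:
  assumes "finite H"
  shows "finite (perfect_matchings H)"
proof (rule finite_subset)
  show "perfect_matchings H \<subseteq> Pow (Pow H)"
    by (auto simp: perfect_matchings_def partition_on_def)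
qed (use assms in simp)

lemma finite_half_edges: "finite (half_edges d n)"
  by (simp add: half_edges_def)

lemma even_card_half_edges: "even (card (half_edges d n))"
proof -
  have "card (half_edges d n) = (\<Sum>i<n. vertex_degree d n i)"
    by (simp add: half_edges_def)
  also have "\<dots> = (\<Sum>i<n. d + (if i = 0 then (if odd (d * n) then 1 else 0) else 0))"
    by (intro sum.cong) (auto simp: vertex_degree_def)
  also have "\<dots> = d * n + (if odd (d * n) then 1 else 0)"
    by (cases n) (auto simp: sum.distrib)
  finally show ?thesis by simp
qed

lemma set_pmf_configuration_model:
  "set_pmf (configuration_model d n) = perfect_matchings (half_edges d n)"
  unfolding configuration_model_def
  by (intro set_pmf_of_set perfect_matchings_nonempty finite_perfect_matchings
      finite_half_edges even_card_half_edges)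

lemma finite_spin_configs: "finite (spin_configs n)"
  unfolding spin_configs_def by (intro finite_PiE) auto

lemma annealed_partition_function_eq:
  "annealed_partition_function d n \<beta> B = (\<Sum>\<sigma>\<in>spin_configs n.
     measure_pmf.expectation (configuration_model d n) (\<lambda>P. exp (- hamiltonian n \<beta> B P \<sigma>)))"
  unfolding annealed_partition_function_def partition_function_def
  by (intro Bochner_Integration.integral_sum integrable_measure_pmf_finite)
    (simp add: set_pmf_configuration_model finite_perfect_matchings finite_half_edges)

lemma boltzmann_expectation_pos:
  "measure_pmf.expectation (configuration_model d n) (\<lambda>P. exp (- hamiltonian n \<beta> B P \<sigma>)) > 0"
proof -
  let ?M = "perfect_matchings (half_edges d n)"
  have fin: "finite ?M" and ne: "?M \<noteq> {}"
    by (intro finite_perfect_matchings perfect_matchings_nonempty finite_half_edges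
        even_card_half_edges)+
  show ?thesis
    unfolding configuration_model_def integral_pmf_of_set[OF ne fin]
    using fin ne by (intro divide_pos_pos sum_pos) (auto simp: card_gt_0_iff)
qed

lemma prob_space_annealed_measure: "prob_space (annealed_measure d n \<beta> B)"
proof
  let ?w = "\<lambda>\<sigma>. measure_pmf.expectation (configuration_model d n)
    (\<lambda>P. exp (- hamiltonian n \<beta> B P \<sigma>))"
  have "spin_configs n \<noteq> {}" by (simp add: spin_configs_def PiE_eq_empty_iff)
  then have Z: "annealed_partition_function d n \<beta> B > 0"
    unfolding annealed_partition_function_eq
    by (intro sum_pos finite_spin_configs boltzmann_expectation_pos)
  have nn: "?w \<sigma> / annealed_partition_function d n \<beta> B \<ge> 0" for \<sigma>
    using Z boltzmann_expectation_pos by (simp add: less_imp_le)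
  have "emeasure (annealed_measure d n \<beta> B) (space (annealed_measure d n \<beta> B))
      = (\<Sum>\<sigma>\<in>spin_configs n. ennreal (?w \<sigma> / annealed_partition_function d n \<beta> B))"
    unfolding annealed_measure_def
    by (subst emeasure_point_measure_finite) (auto simp: space_point_measure finite_spin_configs)
  also have "\<dots> = ennreal (\<Sum>\<sigma>\<in>spin_configs n. ?w \<sigma> / annealed_partition_function d n \<beta> B)"
    using nn by (intro sum_ennreal)
  also have "\<dots> = 1"
    using Z by (simp flip: sum_divide_distrib annealed_partition_function_eq)
  finally show "emeasure (annealed_measure d n \<beta> B) (space (annealed_measure d n \<beta> B)) = 1" .
qed

end

theory Submission
  imports Defs
begin

text \<open>
  Expanding the Boltzmann factor over a uniformly random perfect matching gives a Gaussian moment: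
  if \<open>g\<^sub>+\<close> and \<open>g\<^sub>-\<close> are centred Gaussians with covariance \<open>E(g\<^sub>s g\<^sub>r) = exp (\<beta> * s * r)\<close>, a positive
  semidefinite matrix because \<open>\<beta> \<ge> 0\<close>, then by Wick's formula the sum over all matchings of the
  product of \<open>exp (\<beta> * s * r)\<close> over the pairs equals the expectation of the product of the \<open>g\<^sub>s\<close> over
  the half-edges. The moment is homogeneous, so the radial part of the planar Gaussian
  splits off and the moment becomes an average over the unit circle of products of the
  \<open>spin_amplitude\<close> functions \<open>u\<close> and \<open>v\<close> of the spins \<open>+1\<close> and \<open>-1\<close>. On the circle, Wick's formula is a
  single integration by parts (lemma \<open>circle_mean_partner\<close>).

  Under the average the spins are independent. For even \<open>d * n\<close> the annealed partition function is,
  up to a factor of polynomial size, the circle average of \<open>\<phi> ^ n\<close> with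
  \<open>\<phi> = exp B * u ^ d + exp (- B) * v ^ d\<close>; one raised degree changes only one factor. Hence the
  pressure is the logarithm of \<open>max \<bar>\<phi>\<bar>\<close> (lemma \<open>pressure_limit\<close>). This maximum is the support
  function of a compact planar curve, evaluated at \<open>(exp B, exp (- B))\<close>, and a support function is
  differentiable wherever the supporting point is unique. For \<open>B > 0\<close> a maximizer solves a one-variable
  equation, which is the mean-field equation of the Ising model on the regular tree, and a sign
  analysis of its derivative leaves only one solution (lemma \<open>bethe_equation_unique\<close>). The case
  \<open>B < 0\<close> follows by the symmetry \<open>B \<mapsto> - B\<close>.

  Everything else is convexity. The finite-volume pressures are logarithmic moment generating
  functions of the total spin, hence convex, and the finite-volume magnetization is the slope of a
  tangent. Tangent slopes of convex functions converge where the limit is differentiable, and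
  Chernoff's bound turns differentiability into exponential concentration. At \<open>B = 0\<close> the
  definition of the critical temperature decides: the slopes at \<open>B > 0\<close> do not increase as \<open>B\<close>
  decreases to \<open>0\<close>, their limit is nonnegative, and if it were positive, \<open>\<beta>\<close> would belong to the
  set whose infimum is the critical inverse temperature. So below that temperature the limit is \<open>0\<close>, and the even convex pressure is
  differentiable at \<open>0\<close>.
\<close>

section \<open>Sums over perfect matchings\<close>

lemma perfect_matchings_iff:
  "P \<in> perfect_matchings H \<longleftrightarrow> \<Union>P = H \<and> disjoint P \<and> (\<forall>e\<in>P. card e = 2)"
  by (auto simp: perfect_matchings_def partition_on_def)

lemma perfect_matchings_empty: "perfect_matchings {} = {{}}"
  by (fastforce simp: perfect_matchings_iff)

text \<open>
  A perfect matching of \<open>H\<close> is determined by the partner of one fixed point \<open>x\<close> and by a perfect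
  matching of the remaining points.
\<close>

lemma bij_betw_partner:
  assumes x: "x \<in> H"
  shows "bij_betw (\<lambda>(y, P). insert {x, y} P)
           (SIGMA y:H - {x}. perfect_matchings (H - {x, y})) (perfect_matchings H)"
proof (rule bij_betw_imageI)
  let ?S = "SIGMA y:H - {x}. perfect_matchings (H - {x, y})"
  have fresh: "e \<inter> {x, y} = {}" if "P \<in> perfect_matchings (H - {x, y})" "e \<in> P" for y P e
    using that by (auto simp: perfect_matchings_iff)
  show "inj_on (\<lambda>(y, P). insert {x, y} P) ?S"
  proof (rule inj_onI)
    fix z z' assume z: "z \<in> ?S" "z' \<in> ?S"
      and eq': "(\<lambda>(y, P). insert {x, y} P) z = (\<lambda>(y, P). insert {x, y} P) z'"
    obtain y P y' P' where zz: "z = (y, P)" "z' = (y', P')" by (metis prod.exhaust)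
    have y: "y \<noteq> x" "y' \<noteq> x" and P: "P \<in> perfect_matchings (H - {x, y})"
      and P': "P' \<in> perfect_matchings (H - {x, y'})" using z zz by auto
    have eq: "insert {x, y} P = insert {x, y'} P'" using eq' zz by simp
    have "{x, y} \<in> insert {x, y'} P'" using eq by blast
    then have "{x, y} = {x, y'}" using fresh[OF P'] by blast
    then have yy: "y = y'" using y by (auto simp: doubleton_eq_iff)
    have "{x, y} \<notin> P" "{x, y} \<notin> P'" using fresh[OF P] fresh[OF P'] yy by blast+
    then have "P = P'" using eq yy by (metis insert_ident)
    then show "z = z'" using yy zz by simp
  qed
  show "(\<lambda>(y, P). insert {x, y} P) ` ?S = perfect_matchings H"
  proof (intro equalityI subsetI)
    fix Q assume "Q \<in> (\<lambda>(y, P). insert {x, y} P) ` ?S"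
    then obtain y P where y: "y \<in> H" "y \<noteq> x" and P: "P \<in> perfect_matchings (H - {x, y})"
      and Q: "Q = insert {x, y} P" by auto
    have "disjoint Q" unfolding Q
      using P fresh[OF P] by (auto simp: perfect_matchings_iff disjoint_def)
    then show "Q \<in> perfect_matchings H"
      using P y x by (auto simp: perfect_matchings_iff Q)
  next
    fix Q assume Q: "Q \<in> perfect_matchings H"
    then obtain e where e: "e \<in> Q" "x \<in> e" using x by (auto simp: perfect_matchings_iff)
    then have "card e = 2" using Q by (auto simp: perfect_matchings_iff)
    then obtain y where y: "e = {x, y}" "y \<noteq> x" using e by (auto simp: card_2_iff)
    have disj: "f \<inter> {x, y} = {}" if "f \<in> Q" "f \<noteq> e" for f
      using Q e(1) that y(1) by (auto simp: perfect_matchings_iff disjoint_def)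
    have "\<Union>(Q - {e}) = H - {x, y}"
      using Q e(1) y(1) disj by (auto simp: perfect_matchings_iff)
    then have "Q - {e} \<in> perfect_matchings (H - {x, y})"
      using Q by (auto simp: perfect_matchings_iff disjoint_def)
    moreover have "y \<in> H - {x}" using Q e(1) y by (auto simp: perfect_matchings_iff)
    moreover have "Q = insert {x, y} (Q - {e})" using e y by auto
    ultimately show "Q \<in> (\<lambda>(y, P). insert {x, y} P) ` ?S"
      by (intro image_eqI[where x = "(y, Q - {e})"]) simp_all
  qed
qed

lemma finite_in_perfect_matchings:
  "finite H \<Longrightarrow> P \<in> perfect_matchings H \<Longrightarrow> finite P"
  by (metis perfect_matchings_iff finite_UnionD)

lemma sum_perfect_matchings_partner:
  fixes q :: "'a set \<Rightarrow> real"
  assumes H: "finite H" and x: "x \<in> H"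
  shows "(\<Sum>P\<in>perfect_matchings H. \<Prod>e\<in>P. q e) =
    (\<Sum>y\<in>H - {x}. q {x, y} * (\<Sum>P\<in>perfect_matchings (H - {x, y}). \<Prod>e\<in>P. q e))"
proof -
  have "(\<Sum>P\<in>perfect_matchings H. \<Prod>e\<in>P. q e) =
      (\<Sum>z\<in>(SIGMA y:H - {x}. perfect_matchings (H - {x, y})). \<Prod>e\<in>insert {x, fst z} (snd z). q e)"
    by (subst sum.reindex_bij_betw[OF bij_betw_partner[OF x], symmetric])
       (simp add: case_prod_beta)
  also have "\<dots> = (\<Sum>y\<in>H - {x}. \<Sum>P\<in>perfect_matchings (H - {x, y}). \<Prod>e\<in>insert {x, y} P. q e)"
    using H by (subst sum.Sigma) (auto simp: case_prod_beta finite_perfect_matchings)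
  also have "\<dots> = (\<Sum>y\<in>H - {x}. \<Sum>P\<in>perfect_matchings (H - {x, y}). q {x, y} * (\<Prod>e\<in>P. q e))"
  proof (intro sum.cong refl)
    fix y P assume P: "P \<in> perfect_matchings (H - {x, y})"
    then have "{x, y} \<notin> P" by (auto simp: perfect_matchings_iff)
    moreover have "finite P" using finite_in_perfect_matchings[OF _ P] H by simp
    ultimately show "(\<Prod>e\<in>insert {x, y} P. q e) = q {x, y} * (\<Prod>e\<in>P. q e)" by simp
  qed
  finally show ?thesis by (simp add: sum_distrib_left)
qed

lemma card_perfect_matchings:
  assumes "finite H" "card H = 2 * k"
  shows "real (card (perfect_matchings H)) = (\<Prod>i<k. 2 * real i + 1)"
  using assms
proof (induction k arbitrary: H)
  case 0
  then show ?case by (simp add: perfect_matchings_empty)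
next
  case (Suc k)
  then obtain x where x: "x \<in> H" by fastforce
  have "real (card (perfect_matchings H)) = (\<Sum>P\<in>perfect_matchings H. \<Prod>e\<in>P. 1)" by simp
  also have "\<dots> = (\<Sum>y\<in>H - {x}. real (card (perfect_matchings (H - {x, y}))))"
    by (subst sum_perfect_matchings_partner[OF Suc.prems(1) x]) simp
  also have "\<dots> = (\<Sum>y\<in>H - {x}. \<Prod>i<k. 2 * real i + 1)"
  proof (intro sum.cong refl Suc.IH)
    fix y assume "y \<in> H - {x}"
    then show "card (H - {x, y}) = 2 * k"
      using Suc.prems x by (subst card_Diff_subset) auto
  qed (use Suc.prems in simp)
  also have "\<dots> = (\<Prod>i<Suc k. 2 * real i + 1)"
    using Suc.prems x by (simp add: mult.commute)
  finally show ?case .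
qed

section \<open>Matching sums as circle averages\<close>

text \<open>
  The planar vectors \<open>(sqrt (cosh \<beta>), s * sqrt (sinh \<beta>))\<close> for \<open>s = 1\<close> and \<open>s = -1\<close> have the Gram matrix
  \<open>exp (\<beta> * s * r)\<close>. The amplitude is the inner product of such a vector with the unit vector at
  angle \<open>\<theta>\<close>: the angular part of a Gaussian variable with this covariance.
\<close>

definition spin_amplitude :: "real \<Rightarrow> real \<Rightarrow> real \<Rightarrow> real" where
  "spin_amplitude \<beta> s \<theta> = sqrt (cosh \<beta>) * cos \<theta> + s * sqrt (sinh \<beta>) * sin \<theta>"

definition circle_mean :: "(real \<Rightarrow> real) \<Rightarrow> real" where
  "circle_mean f = integral {0..2 * pi} f / (2 * pi)"

lemma spin_amplitude_deriv:
  "(spin_amplitude \<beta> s has_real_derivative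
      s * sqrt (sinh \<beta>) * cos \<theta> - sqrt (cosh \<beta>) * sin \<theta>) (at \<theta> within A)"
  unfolding spin_amplitude_def by (auto intro!: derivative_eq_intros)

lemma continuous_on_spin_amplitude [continuous_intros]:
  fixes f :: "real \<Rightarrow> real"
  shows "continuous_on A f \<Longrightarrow> continuous_on A (\<lambda>x. spin_amplitude \<beta> s (f x))"
  unfolding spin_amplitude_def by (intro continuous_intros)

text \<open>
  Differentiating an amplitude in the angle rotates the unit vector by a quarter turn. The sum of the
  two products is therefore the inner product of the two planar vectors behind the amplitudes.
\<close>

lemma spin_amplitude_covariance:
  assumes "\<beta> \<ge> 0" and "s \<in> {-1, 1}" "r \<in> {-1, 1}"
  shows "(s * sqrt (sinh \<beta>) * cos \<theta> - sqrt (cosh \<beta>) * sin \<theta>) *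
           (r * sqrt (sinh \<beta>) * cos \<theta> - sqrt (cosh \<beta>) * sin \<theta>)
         + spin_amplitude \<beta> s \<theta> * spin_amplitude \<beta> r \<theta> = exp (\<beta> * (s * r))"
proof -
  define a b where "a = sqrt (cosh \<beta>)" and "b = sqrt (sinh \<beta>)"
  have ab: "a^2 = cosh \<beta>" "b^2 = sinh \<beta>"
    using assms(1) cosh_real_pos[of \<beta>] by (simp_all add: a_def b_def)
  have cs: "(cos \<theta>)^2 + (sin \<theta>)^2 = 1" by simp
  have "(s * b * cos \<theta> - a * sin \<theta>) * (r * b * cos \<theta> - a * sin \<theta>)
         + (a * cos \<theta> + s * b * sin \<theta>) * (a * cos \<theta> + r * b * sin \<theta>)
         = (a^2 + s * r * b^2) * ((cos \<theta>)^2 + (sin \<theta>)^2)" by algebra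
  also have "\<dots> = cosh \<beta> + s * r * sinh \<beta>" using cs ab by simp
  also have "\<dots> = exp (\<beta> * (s * r))"
    using assms(2,3) by (auto simp: cosh_plus_sinh cosh_minus_sinh)
  finally show ?thesis by (simp add: spin_amplitude_def a_def b_def)
qed

text \<open>
  Wick's formula on the circle. The second derivative of an amplitude \<open>g\<close> is \<open>- g\<close>, so the factor of
  \<open>x\<close> can be written as a derivative and integrated by parts against the other factors. Every \<open>y\<close> then
  contributes the product of two first derivatives, which by the covariance identity is
  \<open>exp (\<beta> * s x * s y)\<close> minus the product of the amplitudes themselves. The subtracted terms add up to
  \<open>card H - 1\<close> further copies of the integral on the left; this is where \<open>card H\<close> comes from.
\<close>

lemma circle_mean_partner:
  assumes H: "finite H" and x: "x \<in> H" and \<beta>: "\<beta> \<ge> 0" and s: "\<And>y. y \<in> H \<Longrightarrow> s y \<in> {-1, 1}"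
  shows "real (card H) * circle_mean (\<lambda>\<theta>. \<Prod>y\<in>H. spin_amplitude \<beta> (s y) \<theta>) =
    (\<Sum>y\<in>H - {x}. exp (\<beta> * (s x * s y)) *
       circle_mean (\<lambda>\<theta>. \<Prod>z\<in>H - {x, y}. spin_amplitude \<beta> (s z) \<theta>))"
proof -
  define g where "g y = spin_amplitude \<beta> (s y)" for y
  define g' where "g' y \<theta> = s y * sqrt (sinh \<beta>) * cos \<theta> - sqrt (cosh \<beta>) * sin \<theta>" for y \<theta>
  define E where "E y = exp (\<beta> * (s x * s y))" for y
  define I where "I A = integral {0..2 * pi} (\<lambda>\<theta>. \<Prod>y\<in>A. g y \<theta>)" for A
  have cont: "continuous_on {0..2 * pi} (\<lambda>\<theta>. \<Prod>y\<in>A. g y \<theta>)" for A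
    unfolding g_def by (intro continuous_intros)
  have int: "((\<lambda>\<theta>. \<Prod>y\<in>A. g y \<theta>) has_integral I A) {0..2 * pi}" for A
    unfolding I_def using integrable_continuous_interval[OF cont] by (rule integrable_integral)
  have g: "(g y has_real_derivative g' y \<theta>) (at \<theta> within A)" for y \<theta> A
    unfolding g_def g'_def by (rule spin_amplitude_deriv)
  have g2: "(g' y has_real_derivative - g y \<theta>) (at \<theta> within A)" for y \<theta> A
    unfolding g_def g'_def spin_amplitude_def by (auto intro!: derivative_eq_intros)
  have gg: "g' x \<theta> * g' y \<theta> = E y - g x \<theta> * g y \<theta>" if "y \<in> H" for y \<theta>
    using spin_amplitude_covariance[OF \<beta> s[OF x] s[OF that], of \<theta>]
    by (simp add: g_def g'_def E_def algebra_simps)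
  have split: "(\<Prod>z\<in>H. g z \<theta>) = g x \<theta> * (g y \<theta> * (\<Prod>z\<in>H - {x, y}. g z \<theta>))" if "y \<in> H - {x}" for y \<theta>
  proof -
    have "(\<Prod>z\<in>H. g z \<theta>) = g x \<theta> * (\<Prod>z\<in>H - {x}. g z \<theta>)" by (rule prod.remove[OF H x])
    also have "(\<Prod>z\<in>H - {x}. g z \<theta>) = g y \<theta> * (\<Prod>z\<in>H - {x} - {y}. g z \<theta>)"
      using H that by (intro prod.remove) auto
    also have "H - {x} - {y} = H - {x, y}" by auto
    finally show ?thesis .
  qed
  define D where "D \<theta> = (\<Sum>y\<in>H - {x}. E y * (\<Prod>z\<in>H - {x, y}. g z \<theta>)) - real (card H) * (\<Prod>z\<in>H. g z \<theta>)" for \<theta>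
  have D: "((\<lambda>\<theta>. g' x \<theta> * (\<Prod>y\<in>H - {x}. g y \<theta>)) has_real_derivative D \<theta>) (at \<theta>)" for \<theta>
  proof -
    have "((\<lambda>\<theta>. \<Prod>y\<in>H - {x}. g y \<theta>) has_real_derivative
        (\<Sum>y\<in>H - {x}. g' y \<theta> * (\<Prod>z\<in>H - {x} - {y}. g z \<theta>))) (at \<theta>)"
      by (rule has_field_derivative_prod) (rule g)
    note DERIV_mult[OF g2[of x \<theta> UNIV] this]
    moreover have "- g x \<theta> * (\<Prod>y\<in>H - {x}. g y \<theta>) + (\<Sum>y\<in>H - {x}. g' y \<theta> * (\<Prod>z\<in>H - {x} - {y}. g z \<theta>)) * g' x \<theta> = D \<theta>"
    proof -
      have "(\<Sum>y\<in>H - {x}. g' y \<theta> * (\<Prod>z\<in>H - {x} - {y}. g z \<theta>)) * g' x \<theta>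
          = (\<Sum>y\<in>H - {x}. (E y - g x \<theta> * g y \<theta>) * (\<Prod>z\<in>H - {x, y}. g z \<theta>))"
        unfolding sum_distrib_right
      proof (intro sum.cong refl)
        fix y assume "y \<in> H - {x}"
        moreover have "H - {x} - {y} = H - {x, y}" by auto
        ultimately show "g' y \<theta> * (\<Prod>z\<in>H - {x} - {y}. g z \<theta>) * g' x \<theta> =
          (E y - g x \<theta> * g y \<theta>) * (\<Prod>z\<in>H - {x, y}. g z \<theta>)"
          using gg[of y \<theta>] by (simp add: mult_ac)
      qed
      also have "\<dots> = (\<Sum>y\<in>H - {x}. E y * (\<Prod>z\<in>H - {x, y}. g z \<theta>) - (\<Prod>z\<in>H. g z \<theta>))"
        by (intro sum.cong refl) (simp add: split algebra_simps)
      also have "\<dots> = (\<Sum>y\<in>H - {x}. E y * (\<Prod>z\<in>H - {x, y}. g z \<theta>)) - real (card (H - {x})) * (\<Prod>z\<in>H. g z \<theta>)"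
        by (simp add: sum_subtractf)
      also have "real (card (H - {x})) = real (card H) - 1"
        using H x by (metis card_Suc_Diff1 of_nat_Suc add_diff_cancel_left')
      finally show ?thesis
        using prod.remove[OF H x, of "\<lambda>y. g y \<theta>"] by (simp add: D_def algebra_simps)
    qed
    ultimately show ?thesis by (metis (no_types, lifting))
  qed
  \<comment> \<open>The function \<open>D\<close> is the derivative of a periodic function, so its integral over a period is \<open>0\<close>.\<close>
  have "(D has_integral (g' x (2 * pi) * (\<Prod>y\<in>H - {x}. g y (2 * pi)) - g' x 0 * (\<Prod>y\<in>H - {x}. g y 0))) {0..2 * pi}"
    using D by (intro fundamental_theorem_of_calculus)
      (simp_all add: has_real_derivative_iff_has_vector_derivative[symmetric]
        has_field_derivative_at_within)
  moreover have "g' x (2 * pi) * (\<Prod>y\<in>H - {x}. g y (2 * pi)) - g' x 0 * (\<Prod>y\<in>H - {x}. g y 0) = 0"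
    by (simp add: g_def g'_def spin_amplitude_def)
  ultimately have "(D has_integral 0) {0..2 * pi}" by metis
  moreover have "(D has_integral (\<Sum>y\<in>H - {x}. E y * I (H - {x, y})) - real (card H) * I H) {0..2 * pi}"
    unfolding D_def using H
    by (intro has_integral_diff has_integral_sum has_integral_mult_right int) auto
  ultimately have "(\<Sum>y\<in>H - {x}. E y * I (H - {x, y})) - real (card H) * I H = 0"
    by (rule has_integral_unique[symmetric])
  then have "real (card H) * I H / (2 * pi) = (\<Sum>y\<in>H - {x}. E y * I (H - {x, y})) / (2 * pi)" by simp
  then show ?thesis
    by (simp add: sum_divide_distrib circle_mean_def I_def g_def E_def)
qed

text \<open>
  Both sides satisfy the recursion over the partner of a fixed point; the factor \<open>card H\<close> of
  \<open>circle_mean_partner\<close> accumulates to the double factorial of \<open>2 * k\<close>.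
\<close>

lemma sum_perfect_matchings_eq_circle_mean:
  assumes "finite H" "card H = 2 * k" and \<beta>: "\<beta> \<ge> 0" and "\<And>y. y \<in> H \<Longrightarrow> s y \<in> {-1, 1}"
  shows "(\<Sum>P\<in>perfect_matchings H. \<Prod>e\<in>P. exp (\<beta> * (\<Prod>y\<in>e. s y))) =
    (\<Prod>i<k. 2 * real i + 2) * circle_mean (\<lambda>\<theta>. \<Prod>y\<in>H. spin_amplitude \<beta> (s y) \<theta>)"
  using assms(1,2,4)
proof (induction k arbitrary: H)
  case 0
  then show ?case by (simp add: perfect_matchings_empty circle_mean_def)
next
  case (Suc k)
  then obtain x where x: "x \<in> H" by fastforce
  have "(\<Sum>P\<in>perfect_matchings H. \<Prod>e\<in>P. exp (\<beta> * (\<Prod>y\<in>e. s y))) =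
    (\<Sum>y\<in>H - {x}. exp (\<beta> * (\<Prod>y\<in>{x, y}. s y)) *
       (\<Sum>P\<in>perfect_matchings (H - {x, y}). \<Prod>e\<in>P. exp (\<beta> * (\<Prod>y\<in>e. s y))))"
    by (rule sum_perfect_matchings_partner[OF Suc.prems(1) x])
  also have "\<dots> = (\<Sum>y\<in>H - {x}. exp (\<beta> * (s x * s y)) *
      ((\<Prod>i<k. 2 * real i + 2) * circle_mean (\<lambda>\<theta>. \<Prod>z\<in>H - {x, y}. spin_amplitude \<beta> (s z) \<theta>)))"
  proof (intro sum.cong refl arg_cong2[where f = "(*)"] Suc.IH)
    fix y assume y: "y \<in> H - {x}"
    then show "card (H - {x, y}) = 2 * k"
      using Suc.prems x by (subst card_Diff_subset) auto
    show "exp (\<beta> * (\<Prod>y\<in>{x, y}. s y)) = exp (\<beta> * (s x * s y))"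
      using y by (subst prod.insert) auto
  qed (use Suc.prems in auto)
  also have "\<dots> = (\<Prod>i<k. 2 * real i + 2) * (\<Sum>y\<in>H - {x}. exp (\<beta> * (s x * s y)) *
      circle_mean (\<lambda>\<theta>. \<Prod>z\<in>H - {x, y}. spin_amplitude \<beta> (s z) \<theta>))"
    by (simp add: sum_distrib_left mult_ac)
  also have "\<dots> = (\<Prod>i<Suc k. 2 * real i + 2) * circle_mean (\<lambda>\<theta>. \<Prod>y\<in>H. spin_amplitude \<beta> (s y) \<theta>)"
    using circle_mean_partner[OF Suc.prems(1) x \<beta>, of s] Suc.prems
    by (simp flip: mult.assoc) (simp add: algebra_simps)
  finally show ?case .
qed

section \<open>The annealed partition function\<close>

lemma circle_mean_cmult: "circle_mean (\<lambda>\<theta>. c * f \<theta>) = c * circle_mean f"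
  by (simp add: circle_mean_def)

lemma circle_mean_sum:
  assumes "finite A" and "\<And>i. i \<in> A \<Longrightarrow> continuous_on {0..2 * pi} (f i)"
  shows "circle_mean (\<lambda>\<theta>. \<Sum>i\<in>A. f i \<theta>) = (\<Sum>i\<in>A. circle_mean (f i))"
  unfolding circle_mean_def
  by (subst integral_sum[OF assms(1)])
     (auto intro: integrable_continuous_interval assms(2) simp: sum_divide_distrib)

text \<open>
  A self-loop at \<open>i\<close> consists of two half-edges with the same first component, so its two spins
  multiply to \<open>\<sigma> i * \<sigma> i\<close>, the summand of the diagonal term. Every edge is counted for exactly one
  ordered pair \<open>i \<le> j\<close>.
\<close>

lemma edge_energy_eq:
  assumes P: "P \<in> perfect_matchings (half_edges d n)"
  shows "(\<Sum>i<n. \<Sum>j\<in>{i..<n}. real (edge_count P i j) * \<sigma> i * \<sigma> j) =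
         (\<Sum>e\<in>P. \<Prod>y\<in>e. \<sigma> (fst y))"
proof -
  have finP: "finite P" using finite_in_perfect_matchings[OF finite_half_edges P] .
  let ?T = "SIGMA i:{..<n}. {i..<n}"
  have "(\<Sum>i<n. \<Sum>j\<in>{i..<n}. real (edge_count P i j) * \<sigma> i * \<sigma> j) =
      (\<Sum>(i, j)\<in>?T. \<Sum>e\<in>P. if fst ` e = {i, j} then \<sigma> i * \<sigma> j else 0)"
    using finP
    by (simp add: sum.Sigma edge_count_def mult.assoc flip: sum.inter_filter)
  also have "\<dots> = (\<Sum>e\<in>P. \<Sum>(i, j)\<in>?T. if fst ` e = {i, j} then \<sigma> i * \<sigma> j else 0)"
    unfolding case_prod_beta by (rule sum.swap)
  also have "\<dots> = (\<Sum>e\<in>P. \<Prod>y\<in>e. \<sigma> (fst y))"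
  proof (intro sum.cong refl)
    fix e assume e: "e \<in> P"
    then have "card e = 2" using P by (auto simp: perfect_matchings_iff)
    then obtain x y where xy: "e = {x, y}" "x \<noteq> y" by (auto simp: card_2_iff)
    define i j where "i = min (fst x) (fst y)" and "j = max (fst x) (fst y)"
    have "x \<in> half_edges d n" "y \<in> half_edges d n"
      using P e xy by (auto simp: perfect_matchings_iff)
    then have n: "fst x < n" "fst y < n" by (auto simp: half_edges_def)
    have one: "{p \<in> ?T. fst ` e = {fst p, snd p}} = {(i, j)}"
      using n by (auto simp: xy i_def j_def doubleton_eq_iff min_def max_def split: if_splits)
    have "(\<Sum>(i, j)\<in>?T. if fst ` e = {i, j} then \<sigma> i * \<sigma> j else 0)
        = (\<Sum>p\<in>{p \<in> ?T. fst ` e = {fst p, snd p}}. \<sigma> (fst p) * \<sigma> (snd p))"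
      unfolding case_prod_beta by (rule sum.inter_filter[symmetric]) auto
    also have "\<dots> = \<sigma> i * \<sigma> j" unfolding one by simp
    also have "\<dots> = (\<Prod>y\<in>e. \<sigma> (fst y))"
      using xy by (auto simp: i_def j_def min_def max_def)
    finally show "(\<Sum>(i, j)\<in>?T. if fst ` e = {i, j} then \<sigma> i * \<sigma> j else 0) = (\<Prod>y\<in>e. \<sigma> (fst y))" .
  qed
  finally show ?thesis .
qed

text \<open>
  The weight at zero field: the field acts on it by the deterministic factor \<open>exp (B * S)\<close>, with \<open>S\<close> the
  total spin. The annealed measures for varying \<open>B\<close> thus form an exponential family.
\<close>

definition annealed_weight :: "nat \<Rightarrow> nat \<Rightarrow> real \<Rightarrow> (nat \<Rightarrow> real) \<Rightarrow> real" where
  "annealed_weight d n \<beta> \<sigma> =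
     measure_pmf.expectation (configuration_model d n) (\<lambda>P. exp (- hamiltonian n \<beta> 0 P \<sigma>))"

lemma annealed_weight_pos: "annealed_weight d n \<beta> \<sigma> > 0"
  unfolding annealed_weight_def by (rule boltzmann_expectation_pos)

lemma boltzmann_expectation_eq:
  "measure_pmf.expectation (configuration_model d n) (\<lambda>P. exp (- hamiltonian n \<beta> B P \<sigma>)) =
     annealed_weight d n \<beta> \<sigma> * exp (B * total_spin n \<sigma>)"
proof -
  have "exp (- hamiltonian n \<beta> B P \<sigma>) = exp (- hamiltonian n \<beta> 0 P \<sigma>) * exp (B * total_spin n \<sigma>)" for P
    by (simp add: hamiltonian_def total_spin_def flip: exp_add)
  then show ?thesis by (simp add: annealed_weight_def)
qed

lemma annealed_partition_function_weight:
  "annealed_partition_function d n \<beta> B =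
     (\<Sum>\<sigma>\<in>spin_configs n. annealed_weight d n \<beta> \<sigma> * exp (B * total_spin n \<sigma>))"
  unfolding annealed_partition_function_eq boltzmann_expectation_eq ..

text \<open>
  The double factorial of \<open>2 * k\<close>, which comes from the circle average, divided by the number of perfect
  matchings of \<open>2 * k\<close> points.
\<close>

definition wallis_product :: "nat \<Rightarrow> real" where
  "wallis_product k = (\<Prod>i<k. (2 * real i + 2) / (2 * real i + 1))"

text \<open>
  The upper bound telescopes, since \<open>(2 * i + 2) / (2 * i + 1) \<le> (2 * i + 3) / (2 * i + 1)\<close>. Polynomial
  growth makes the factor invisible on the exponential scale.
\<close>

lemma wallis_product_bounds: "1 \<le> wallis_product k" "wallis_product k \<le> 2 * real k + 1"
proof -
  show "1 \<le> wallis_product k"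
    unfolding wallis_product_def by (intro prod_ge_1) (auto simp: field_simps)
  show "wallis_product k \<le> 2 * real k + 1"
  proof (induction k)
    case (Suc k)
    have "wallis_product (Suc k) = wallis_product k * ((2 * real k + 2) / (2 * real k + 1))"
      by (simp add: wallis_product_def)
    also have "\<dots> \<le> (2 * real k + 1) * ((2 * real k + 2) / (2 * real k + 1))"
      by (intro mult_right_mono Suc.IH) auto
    also have "\<dots> \<le> 2 * real (Suc k) + 1" by (simp add: field_simps)
    finally show ?case .
  qed (simp add: wallis_product_def)
qed

definition number_of_edges :: "nat \<Rightarrow> nat \<Rightarrow> nat" where
  "number_of_edges d n = card (half_edges d n) div 2"

lemma annealed_weight_eq_circle_mean:
  assumes \<beta>: "\<beta> \<ge> 0" and \<sigma>: "\<sigma> \<in> spin_configs n"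
  shows "annealed_weight d n \<beta> \<sigma> = wallis_product (number_of_edges d n) *
    circle_mean (\<lambda>\<theta>. \<Prod>i<n. spin_amplitude \<beta> (\<sigma> i) \<theta> ^ vertex_degree d n i)"
proof -
  let ?H = "half_edges d n" and ?k = "number_of_edges d n"
  have k: "card ?H = 2 * ?k" using even_card_half_edges[of d n] by (simp add: number_of_edges_def)
  have ne: "perfect_matchings ?H \<noteq> {}" and fin: "finite (perfect_matchings ?H)"
    by (intro perfect_matchings_nonempty finite_perfect_matchings finite_half_edges even_card_half_edges)+
  have "annealed_weight d n \<beta> \<sigma> =
      (\<Sum>P\<in>perfect_matchings ?H. exp (- hamiltonian n \<beta> 0 P \<sigma>)) / card (perfect_matchings ?H)"
    unfolding annealed_weight_def configuration_model_def integral_pmf_of_set[OF ne fin] ..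
  also have "(\<Sum>P\<in>perfect_matchings ?H. exp (- hamiltonian n \<beta> 0 P \<sigma>)) =
      (\<Sum>P\<in>perfect_matchings ?H. \<Prod>e\<in>P. exp (\<beta> * (\<Prod>y\<in>e. \<sigma> (fst y))))"
  proof (intro sum.cong refl)
    fix P assume P: "P \<in> perfect_matchings ?H"
    have "finite P" using finite_in_perfect_matchings[OF finite_half_edges P] .
    moreover have "- hamiltonian n \<beta> 0 P \<sigma> = (\<Sum>e\<in>P. \<beta> * (\<Prod>y\<in>e. \<sigma> (fst y)))"
      by (simp add: hamiltonian_def edge_energy_eq[OF P] flip: sum_distrib_left)
    ultimately show "exp (- hamiltonian n \<beta> 0 P \<sigma>) = (\<Prod>e\<in>P. exp (\<beta> * (\<Prod>y\<in>e. \<sigma> (fst y))))"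
      by (simp add: exp_sum)
  qed
  also have "\<dots> = (\<Prod>i<?k. 2 * real i + 2) *
      circle_mean (\<lambda>\<theta>. \<Prod>y\<in>?H. spin_amplitude \<beta> (\<sigma> (fst y)) \<theta>)"
    using \<sigma> by (intro sum_perfect_matchings_eq_circle_mean[OF finite_half_edges k \<beta>])
      (auto simp: spin_configs_def half_edges_def PiE_def Pi_def)
  also have "real (card (perfect_matchings ?H)) = (\<Prod>i<?k. 2 * real i + 1)"
    by (rule card_perfect_matchings[OF finite_half_edges k])
  also have "(\<lambda>\<theta>. \<Prod>y\<in>?H. spin_amplitude \<beta> (\<sigma> (fst y)) \<theta>) =
      (\<lambda>\<theta>. \<Prod>i<n. spin_amplitude \<beta> (\<sigma> i) \<theta> ^ vertex_degree d n i)"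
    unfolding half_edges_def
    by (rule ext, subst prod.Sigma[symmetric, where g = "\<lambda>i h. spin_amplitude \<beta> (\<sigma> i) \<theta>" for \<theta>, unfolded case_prod_beta]) auto
  finally show ?thesis by (simp add: wallis_product_def prod_dividef)
qed

text \<open>
  The sum over the spin of one vertex of degree \<open>k\<close>, including its field term.
\<close>

definition site_weight :: "nat \<Rightarrow> real \<Rightarrow> real \<Rightarrow> real \<Rightarrow> real" where
  "site_weight k \<beta> B \<theta> = exp B * spin_amplitude \<beta> 1 \<theta> ^ k + exp (- B) * spin_amplitude \<beta> (- 1) \<theta> ^ k"

lemma continuous_on_site_weight: "continuous_on A (site_weight k \<beta> B)"
  unfolding site_weight_def by (intro continuous_intros)

text \<open>
  For a fixed angle the summand is a product over the vertices, so the sum over all spin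
  configurations factorizes.
\<close>

lemma annealed_partition_function_eq_circle_mean:
  assumes \<beta>: "\<beta> \<ge> 0"
  shows "annealed_partition_function d n \<beta> B = wallis_product (number_of_edges d n) *
    circle_mean (\<lambda>\<theta>. \<Prod>i<n. site_weight (vertex_degree d n i) \<beta> B \<theta>)"
proof -
  let ?W = "wallis_product (number_of_edges d n)"
  have "annealed_partition_function d n \<beta> B = (\<Sum>\<sigma>\<in>spin_configs n. ?W *
      circle_mean (\<lambda>\<theta>. \<Prod>i<n. exp (B * \<sigma> i) * spin_amplitude \<beta> (\<sigma> i) \<theta> ^ vertex_degree d n i))"
    unfolding annealed_partition_function_weight
  proof (intro sum.cong refl)
    fix \<sigma> assume \<sigma>: "\<sigma> \<in> spin_configs n"
    have "exp (B * total_spin n \<sigma>) = (\<Prod>i<n. exp (B * \<sigma> i))"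
      by (simp add: total_spin_def sum_distrib_left exp_sum)
    then show "annealed_weight d n \<beta> \<sigma> * exp (B * total_spin n \<sigma>) = ?W *
        circle_mean (\<lambda>\<theta>. \<Prod>i<n. exp (B * \<sigma> i) * spin_amplitude \<beta> (\<sigma> i) \<theta> ^ vertex_degree d n i)"
      by (simp add: annealed_weight_eq_circle_mean[OF \<beta> \<sigma>] prod.distrib circle_mean_cmult)
  qed
  also have "\<dots> = ?W * circle_mean (\<lambda>\<theta>. \<Sum>\<sigma>\<in>spin_configs n.
      \<Prod>i<n. exp (B * \<sigma> i) * spin_amplitude \<beta> (\<sigma> i) \<theta> ^ vertex_degree d n i)"
  proof -
    have "continuous_on {0..2 * pi}
        (\<lambda>\<theta>. \<Prod>i<n. exp (B * \<sigma> i) * spin_amplitude \<beta> (\<sigma> i) \<theta> ^ vertex_degree d n i)" for \<sigma>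
      by (intro continuous_intros)
    then show ?thesis by (subst circle_mean_sum[OF finite_spin_configs]) (simp_all add: sum_distrib_left)
  qed
  also have "(\<lambda>\<theta>. \<Sum>\<sigma>\<in>spin_configs n. \<Prod>i<n. exp (B * \<sigma> i) * spin_amplitude \<beta> (\<sigma> i) \<theta> ^ vertex_degree d n i)
      = (\<lambda>\<theta>. \<Prod>i<n. \<Sum>s\<in>{-1, 1}. exp (B * s) * spin_amplitude \<beta> s \<theta> ^ vertex_degree d n i)"
    unfolding spin_configs_def by (rule ext, subst prod_sum_PiE) auto
  also have "\<dots> = (\<lambda>\<theta>. \<Prod>i<n. site_weight (vertex_degree d n i) \<beta> B \<theta>)"
    by (simp add: site_weight_def add.commute)
  finally show ?thesis .
qed

section \<open>Exponential growth of the partition function\<close>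

lemma circle_mean_mono:
  assumes "continuous_on {0..2 * pi} f" "continuous_on {0..2 * pi} g"
    and "\<And>\<theta>. \<theta> \<in> {0..2 * pi} \<Longrightarrow> f \<theta> \<le> g \<theta>"
  shows "circle_mean f \<le> circle_mean g"
  unfolding circle_mean_def
  by (intro divide_right_mono integral_le integrable_continuous_interval assms) auto

lemma circle_mean_const: "circle_mean (\<lambda>_. c) = c"
  by (simp add: circle_mean_def)

lemma circle_mean_power_le:
  assumes "continuous_on {0..2 * pi} w" "continuous_on {0..2 * pi} f"
    and "\<And>\<theta>. \<theta> \<in> {0..2 * pi} \<Longrightarrow> 0 \<le> f \<theta> \<and> f \<theta> \<le> M"
    and "\<And>\<theta>. \<theta> \<in> {0..2 * pi} \<Longrightarrow> 0 \<le> w \<theta> \<and> w \<theta> \<le> C"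
  shows "circle_mean (\<lambda>\<theta>. w \<theta> * f \<theta> ^ n) \<le> C * M ^ n"
proof -
  have "circle_mean (\<lambda>\<theta>. w \<theta> * f \<theta> ^ n) \<le> circle_mean (\<lambda>_. C * M ^ n)"
  proof (rule circle_mean_mono)
    fix \<theta> :: real assume t: "\<theta> \<in> {0..2 * pi}"
    have "0 \<le> C" using assms(4)[OF t] by linarith
    then show "w \<theta> * f \<theta> ^ n \<le> C * M ^ n"
      using assms(3,4)[OF t] by (intro mult_mono power_mono) auto
  qed (intro continuous_intros assms)+
  then show ?thesis by (simp add: circle_mean_const)
qed

text \<open>
  Laplace's lower bound: near the point \<open>\<theta>0\<close>, on an interval of positive length, \<open>f\<close> exceeds \<open>r\<close> and \<open>w\<close>
  stays away from \<open>0\<close>. The interval is one-sided if \<open>\<theta>0\<close> is an endpoint.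
\<close>

lemma circle_mean_power_ge:
  assumes w: "continuous_on {0..2 * pi} w" and f: "continuous_on {0..2 * pi} f"
    and nonneg: "\<And>\<theta>. \<theta> \<in> {0..2 * pi} \<Longrightarrow> 0 \<le> f \<theta> \<and> 0 \<le> w \<theta>"
    and \<theta>0: "\<theta>0 \<in> {0..2 * pi}" "w \<theta>0 > 0" and r: "0 < r" "r < f \<theta>0"
  shows "\<exists>c>0. \<forall>n. c * r ^ n \<le> circle_mean (\<lambda>\<theta>. w \<theta> * f \<theta> ^ n)"
proof -
  define w0 where "w0 = w \<theta>0 / 2"
  have w0: "0 < w0" "w0 < w \<theta>0" using \<theta>0 by (simp_all add: w0_def)
  have "eventually (\<lambda>\<theta>. w \<theta> > w0) (at \<theta>0 within {0..2 * pi})"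
    using w \<theta>0 w0 by (auto simp: continuous_on_def intro: order_tendstoD)
  moreover have "eventually (\<lambda>\<theta>. f \<theta> > r) (at \<theta>0 within {0..2 * pi})"
    using f \<theta>0 r by (auto simp: continuous_on_def intro: order_tendstoD)
  ultimately have "eventually (\<lambda>\<theta>. w \<theta> > w0 \<and> f \<theta> > r) (at \<theta>0 within {0..2 * pi})"
    by eventually_elim simp
  then obtain \<delta> where \<delta>: "\<delta> > 0"
    "\<And>\<theta>. \<theta> \<in> {0..2 * pi} \<Longrightarrow> \<theta> \<noteq> \<theta>0 \<Longrightarrow> dist \<theta> \<theta>0 < \<delta> \<Longrightarrow> w \<theta> > w0 \<and> f \<theta> > r"
    unfolding eventually_at by blast
  define x y where "x = max 0 (\<theta>0 - \<delta> / 2)" and "y = min (2 * pi) (\<theta>0 + \<delta> / 2)"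
  have xy: "x < y" "{x..y} \<subseteq> {0..2 * pi}"
    using \<theta>0 \<delta>(1) pi_gt_zero unfolding x_def y_def by (auto simp: max_def min_def)
  have near: "w \<theta> \<ge> w0 \<and> f \<theta> \<ge> r" if "\<theta> \<in> {x..y}" for \<theta>
  proof (cases "\<theta> = \<theta>0")
    case True
    then show ?thesis using r w0 by simp
  next
    case False
    have "dist \<theta> \<theta>0 < \<delta>" using that \<delta>(1) by (auto simp: x_def y_def dist_real_def)
    then show ?thesis using \<delta>(2)[of \<theta>] False that xy(2) by fastforce
  qed
  have "(y - x) * w0 / (2 * pi) * r ^ n \<le> circle_mean (\<lambda>\<theta>. w \<theta> * f \<theta> ^ n)" for n
  proof -
    have cont: "continuous_on {0..2 * pi} (\<lambda>\<theta>. w \<theta> * f \<theta> ^ n)" by (intro continuous_intros w f)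
    have "(y - x) * (w0 * r ^ n) = integral {x..y} (\<lambda>_. w0 * r ^ n)" using xy by simp
    also have "\<dots> \<le> integral {x..y} (\<lambda>\<theta>. w \<theta> * f \<theta> ^ n)"
    proof (rule integral_le)
      show "(\<lambda>_. w0 * r ^ n) integrable_on {x..y}"
        by (intro integrable_continuous_interval continuous_on_const)
      show "(\<lambda>\<theta>. w \<theta> * f \<theta> ^ n) integrable_on {x..y}"
        using continuous_on_subset[OF cont xy(2)] by (rule integrable_continuous_interval)
      show "w0 * r ^ n \<le> w \<theta> * f \<theta> ^ n" if "\<theta> \<in> {x..y}" for \<theta>
        using near[OF that] w0 r nonneg[of \<theta>] that xy by (intro mult_mono power_mono) auto
    qed
    also have "\<dots> \<le> integral {0..2 * pi} (\<lambda>\<theta>. w \<theta> * f \<theta> ^ n)"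
      using continuous_on_subset[OF cont xy(2)] cont xy nonneg
      by (intro integral_subset_le integrable_continuous_interval) auto
    finally have "(y - x) * (w0 * r ^ n) / (2 * pi) \<le> circle_mean (\<lambda>\<theta>. w \<theta> * f \<theta> ^ n)"
      unfolding circle_mean_def by (intro divide_right_mono) auto
    then show ?thesis by (simp add: mult.assoc)
  qed
  then show ?thesis using xy w0 by (intro exI[of _ "(y - x) * w0 / (2 * pi)"]) auto
qed

lemma ln_over_n_tendsto:
  fixes Z :: "nat \<Rightarrow> real"
  assumes M: "M > 0"
    and lower: "\<And>r. 0 < r \<Longrightarrow> r < M \<Longrightarrow> \<exists>c>0. \<forall>\<^sub>F n in sequentially. c * r ^ n \<le> Z n"
    and upper: "C > 0" "\<forall>\<^sub>F n in sequentially. Z n \<le> C * (real n + 1) * M ^ n"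
  shows "(\<lambda>n. ln (Z n) / real n) \<longlonglongrightarrow> ln M"
proof (rule order_tendstoI)
  fix a assume "a < ln M"
  then obtain b where b: "a < b" "b < ln M" using dense by blast
  have "exp b < M" using b(2) M by (metis exp_less_cancel_iff exp_ln)
  then obtain c where c: "c > 0" "\<forall>\<^sub>F n in sequentially. c * exp b ^ n \<le> Z n"
    using lower[of "exp b"] by auto
  have "(\<lambda>n. ln c / real n + b) \<longlonglongrightarrow> 0 + b"
    by (intro tendsto_intros real_tendsto_divide_at_top filterlim_real_sequentially)
  then have "\<forall>\<^sub>F n in sequentially. a < ln c / real n + b"
    using b by (intro order_tendstoD(1)) auto
  with c(2) eventually_gt_at_top[of 0] show "\<forall>\<^sub>F n in sequentially. a < ln (Z n) / real n"
  proof eventually_elim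
    case (elim n)
    have "ln (c * exp b ^ n) \<le> ln (Z n)"
      using elim c by (subst ln_le_cancel_iff) (auto intro: less_le_trans[rotated])
    moreover have "ln (c * exp b ^ n) = ln c + real n * b"
      using c by (simp add: ln_mult ln_realpow)
    ultimately have "(ln c + real n * b) / real n \<le> ln (Z n) / real n"
      by (intro divide_right_mono) auto
    then have "ln c / real n + b \<le> ln (Z n) / real n"
      using elim by (simp add: add_divide_distrib)
    with elim show ?case by simp
  qed
next
  fix a assume a: "ln M < a"
  obtain c where c: "c > 0" "\<forall>\<^sub>F n in sequentially. c * (M / 2) ^ n \<le> Z n"
    using lower[of "M / 2"] M by auto
  have "(\<lambda>n. ln (real n + 1) / real n) \<longlonglongrightarrow> 0" by real_asymp
  moreover have "(\<lambda>n. ln C / real n) \<longlonglongrightarrow> 0"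
    by (intro real_tendsto_divide_at_top[OF tendsto_const] filterlim_real_sequentially)
  ultimately have "(\<lambda>n. ln C / real n + ln (real n + 1) / real n + ln M) \<longlonglongrightarrow> 0 + 0 + ln M"
    by (intro tendsto_add tendsto_const)
  then have "\<forall>\<^sub>F n in sequentially. ln C / real n + ln (real n + 1) / real n + ln M < a"
    using a by (intro order_tendstoD(2)) auto
  with c(2) upper(2) eventually_gt_at_top[of 0] show "\<forall>\<^sub>F n in sequentially. ln (Z n) / real n < a"
  proof eventually_elim
    case (elim n)
    have "0 < c * (M / 2) ^ n" using c M by simp
    then have "Z n > 0" using elim by linarith
    then have "ln (Z n) \<le> ln (C * (real n + 1) * M ^ n)"
      using elim by (subst ln_le_cancel_iff) (auto intro: less_le_trans)
    also have "\<dots> = ln C + ln (real n + 1) + real n * ln M"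
      using upper(1) M by (simp add: ln_mult ln_realpow)
    finally have "ln (Z n) / real n \<le> (ln C + ln (real n + 1) + real n * ln M) / real n"
      by (intro divide_right_mono) auto
    then have "ln (Z n) / real n \<le> ln C / real n + ln (real n + 1) / real n + ln M"
      using elim by (simp add: add_divide_distrib)
    with elim show ?case by simp
  qed
qed

lemma card_half_edges: "card (half_edges d n) = d * n + (if odd (d * n) then 1 else 0)"
proof -
  have "card (half_edges d n) = (\<Sum>i<n. vertex_degree d n i)"
    by (simp add: half_edges_def)
  also have "\<dots> = (\<Sum>i<n. d + (if i = 0 then (if odd (d * n) then 1 else 0) else 0))"
    by (intro sum.cong) (auto simp: vertex_degree_def)
  also have "\<dots> = d * n + (if odd (d * n) then 1 else 0)"
    by (cases n) (auto simp: sum.distrib)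
  finally show ?thesis .
qed

text \<open>
  The absolute value is harmless because \<open>n\<close> is even or the site weight is nonnegative. It gives a
  nonnegative integrand in all cases.
\<close>

lemma annealed_partition_function_even:
  assumes "\<beta> \<ge> 0" "even (d * n)"
  shows "annealed_partition_function d n \<beta> B = wallis_product (number_of_edges d n) *
    circle_mean (\<lambda>\<theta>. 1 * \<bar>site_weight d \<beta> B \<theta>\<bar> ^ n)"
proof -
  have "(\<Prod>i<n. site_weight (vertex_degree d n i) \<beta> B \<theta>) = \<bar>site_weight d \<beta> B \<theta>\<bar> ^ n" for \<theta>
  proof -
    have "(\<Prod>i<n. site_weight (vertex_degree d n i) \<beta> B \<theta>) = site_weight d \<beta> B \<theta> ^ n"
      using assms(2) by (simp add: vertex_degree_def)
    moreover have "site_weight d \<beta> B \<theta> \<ge> 0" if "even d"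
      using that by (simp add: site_weight_def zero_le_even_power)
    ultimately show ?thesis
      using assms(2) by (cases "even n") (auto simp: power_even_abs)
  qed
  then show ?thesis by (simp add: annealed_partition_function_eq_circle_mean[OF assms(1)])
qed

text \<open>
  The vertex \<open>0\<close> has the even degree \<open>d + 1\<close>, hence a nonnegative weight, and the other vertices are
  even in number.
\<close>

lemma annealed_partition_function_odd:
  assumes "\<beta> \<ge> 0" "odd (d * n)"
  shows "annealed_partition_function d n \<beta> B = wallis_product (number_of_edges d n) *
    circle_mean (\<lambda>\<theta>. site_weight (d + 1) \<beta> B \<theta> * \<bar>site_weight d \<beta> B \<theta>\<bar> ^ (n - 1))"
proof -
  obtain m where m: "n = Suc m" using assms(2) by (cases n) auto
  have "(\<Prod>i<n. site_weight (vertex_degree d n i) \<beta> B \<theta>) =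
      site_weight (d + 1) \<beta> B \<theta> * \<bar>site_weight d \<beta> B \<theta>\<bar> ^ (n - 1)" for \<theta>
  proof -
    have "(\<Prod>i<n. site_weight (vertex_degree d n i) \<beta> B \<theta>) =
        site_weight (d + 1) \<beta> B \<theta> * site_weight d \<beta> B \<theta> ^ m"
      using assms(2) unfolding m prod.lessThan_Suc_shift by (simp add: vertex_degree_def)
    moreover have "even m" using assms(2) m by auto
    ultimately show ?thesis by (simp add: m power_even_abs)
  qed
  then show ?thesis by (simp add: annealed_partition_function_eq_circle_mean[OF assms(1)])
qed

text \<open>
  At the maximum point one of the two amplitudes is nonzero, so the weight of even degree \<open>d + 1\<close> is
  positive there and the extra half-edge does not change the exponential rate.
\<close>

lemma pressure_limit_of_max:
  assumes \<beta>: "\<beta> \<ge> 0" and d: "d > 0"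
    and \<theta>0: "\<theta>0 \<in> {0..2 * pi}" and M: "\<bar>site_weight d \<beta> B \<theta>0\<bar> = M" "M > 0"
    and max: "\<And>\<theta>. \<bar>site_weight d \<beta> B \<theta>\<bar> \<le> M"
  shows "(\<lambda>n. ln (annealed_partition_function d n \<beta> B) / real n) \<longlonglongrightarrow> ln M"
proof -
  let ?Z = "\<lambda>n. annealed_partition_function d n \<beta> B"
  let ?W = "\<lambda>n. wallis_product (number_of_edges d n)"
  let ?f = "\<lambda>\<theta>. \<bar>site_weight d \<beta> B \<theta>\<bar>"
  have f: "continuous_on {0..2 * pi} ?f"
    by (intro continuous_intros continuous_on_site_weight)
  obtain C where C: "C > 0" "\<And>\<theta>. \<theta> \<in> {0..2 * pi} \<Longrightarrow> site_weight (d + 1) \<beta> B \<theta> \<le> C"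
  proof -
    have "bounded (site_weight (d + 1) \<beta> B ` {0..2 * pi})"
      by (intro compact_imp_bounded compact_continuous_image continuous_on_site_weight) simp
    then obtain C where "C > 0" "\<forall>x\<in>site_weight (d + 1) \<beta> B ` {0..2 * pi}. norm x \<le> C"
      by (auto simp: bounded_pos)
    then show ?thesis by (intro that[of C]) force+
  qed
  have spin: "spin_amplitude \<beta> 1 \<theta>0 \<noteq> 0 \<or> spin_amplitude \<beta> (-1) \<theta>0 \<noteq> 0"
    using M d by (auto simp: site_weight_def zero_power)
  have odd_nonneg: "site_weight (d + 1) \<beta> B \<theta> \<ge> 0" if "odd d" for \<theta>
    using that by (simp add: site_weight_def zero_le_even_power del: power_Suc)
  have odd_pos: "site_weight (d + 1) \<beta> B \<theta>0 > 0" if "odd d"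
  proof -
    have ev: "even (d + 1)" using that by simp
    have pos: "0 < x ^ (d + 1)" if "x \<noteq> 0" for x :: real
      using ev that by (simp only: zero_less_power_eq) simp
    have nonneg: "0 \<le> x ^ (d + 1)" for x :: real using ev by (rule zero_le_even_power)
    from spin show ?thesis
    proof
      assume "spin_amplitude \<beta> 1 \<theta>0 \<noteq> 0"
      then show ?thesis unfolding site_weight_def
        by (intro add_pos_nonneg mult_pos_pos mult_nonneg_nonneg pos nonneg) auto
    next
      assume "spin_amplitude \<beta> (-1) \<theta>0 \<noteq> 0"
      then show ?thesis unfolding site_weight_def
        by (intro add_nonneg_pos mult_pos_pos mult_nonneg_nonneg pos nonneg) auto
    qed
  qed
  have W_ge: "I \<le> ?W n * I" if "0 \<le> I" for I n
    using mult_right_mono[OF wallis_product_bounds(1) that, of "number_of_edges d n"] by simp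
  show ?thesis
  proof (rule ln_over_n_tendsto[OF M(2)])
    fix r assume r: "0 < r" "r < M"
    obtain c1 where c1: "c1 > 0" "\<And>n. c1 * r ^ n \<le> circle_mean (\<lambda>\<theta>. 1 * ?f \<theta> ^ n)"
      using circle_mean_power_ge[OF continuous_on_const f, of 1 \<theta>0 r] \<theta>0 r M by auto
    obtain c2 where c2: "c2 > 0"
      "odd d \<Longrightarrow> \<forall>n. c2 * r ^ n \<le> circle_mean (\<lambda>\<theta>. site_weight (d + 1) \<beta> B \<theta> * ?f \<theta> ^ n)"
    proof (cases "odd d")
      case True
      then show ?thesis
        using that circle_mean_power_ge[OF continuous_on_site_weight f, of "d + 1" \<beta> B \<theta>0 r] \<theta>0 r M
          odd_nonneg odd_pos by auto
    qed (use that[of 1] in auto)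
    \<comment> \<open>The two bounds are for even and for odd \<open>d * n\<close>; dividing by \<open>r\<close> accounts for the exponent \<open>n - 1\<close>.\<close>
    have "min c1 (c2 / r) * r ^ n \<le> ?Z n" if n: "n > 0" for n
    proof (cases "even (d * n)")
      case True
      have "min c1 (c2 / r) * r ^ n \<le> c1 * r ^ n" using r by (intro mult_right_mono) auto
      also have "\<dots> \<le> circle_mean (\<lambda>\<theta>. 1 * ?f \<theta> ^ n)" by (rule c1)
      also have "\<dots> \<le> ?W n * circle_mean (\<lambda>\<theta>. 1 * ?f \<theta> ^ n)"
      proof (rule W_ge)
        have "0 \<le> c1 * r ^ n" using c1(1) r by simp
        then show "0 \<le> circle_mean (\<lambda>\<theta>. 1 * ?f \<theta> ^ n)" using c1(2)[of n] by linarith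
      qed
      finally show ?thesis using annealed_partition_function_even[OF \<beta> True] by simp
    next
      case False
      have "odd d" using False by auto
      note c2' = c2(2)[OF this, rule_format, of "n - 1"]
      have "min c1 (c2 / r) * r ^ n \<le> c2 / r * r ^ n" using r by (intro mult_right_mono) auto
      also have "\<dots> = c2 * r ^ (n - 1)" using n r by (cases n) auto
      also note c2'
      also have "circle_mean (\<lambda>\<theta>. site_weight (d + 1) \<beta> B \<theta> * ?f \<theta> ^ (n - 1)) \<le>
          ?W n * circle_mean (\<lambda>\<theta>. site_weight (d + 1) \<beta> B \<theta> * ?f \<theta> ^ (n - 1))"
      proof (rule W_ge)
        have "0 \<le> c2 * r ^ (n - 1)" using c2(1) r by simp
        then show "0 \<le> circle_mean (\<lambda>\<theta>. site_weight (d + 1) \<beta> B \<theta> * ?f \<theta> ^ (n - 1))"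
          using c2' by linarith
      qed
      finally show ?thesis using annealed_partition_function_odd[OF \<beta> False] by simp
    qed
    then have "\<forall>\<^sub>F n in sequentially. min c1 (c2 / r) * r ^ n \<le> ?Z n"
      by (rule eventually_mono[OF eventually_gt_at_top[of 0]])
    moreover have "min c1 (c2 / r) > 0" using c1(1) c2(1) r by simp
    ultimately show "\<exists>c>0. \<forall>\<^sub>F n in sequentially. c * r ^ n \<le> ?Z n" by blast
  next
    \<comment> \<open>The summands \<open>1\<close> and \<open>C / M\<close> are the constants for even and for odd \<open>d * n\<close>; the remaining factor
      bounds the Wallis product.\<close>
    show "(real d + 2) * (1 + C / M) > 0" using C M by (simp add: add_pos_pos)
    have W: "0 \<le> ?W n" "?W n \<le> (real d + 2) * (real n + 1)" for n
    proof -
      show "0 \<le> ?W n" using wallis_product_bounds(1)[of "number_of_edges d n"] by linarith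
      have "2 * number_of_edges d n = card (half_edges d n)"
        using even_card_half_edges[of d n] by (simp add: number_of_edges_def)
      also have "\<dots> \<le> d * n + 1" by (simp add: card_half_edges)
      finally have "real (2 * number_of_edges d n) \<le> real (d * n + 1)"
        by (rule of_nat_mono)
      then have "2 * real (number_of_edges d n) \<le> real d * real n + 1" by simp
      then have "?W n \<le> real d * real n + 2"
        using wallis_product_bounds(2)[of "number_of_edges d n"] by linarith
      also have "\<dots> \<le> (real d + 2) * (real n + 1)" by (simp add: algebra_simps)
      finally show "?W n \<le> (real d + 2) * (real n + 1)" .
    qed
    have "?Z n \<le> (real d + 2) * (1 + C / M) * (real n + 1) * M ^ n" if n: "n > 0" for n
    proof -
      have "\<exists>I. ?Z n = ?W n * I \<and> I \<le> (1 + C / M) * M ^ n"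
      proof (cases "even (d * n)")
        case True
        have "circle_mean (\<lambda>\<theta>. 1 * ?f \<theta> ^ n) \<le> 1 * M ^ n"
          by (rule circle_mean_power_le[OF continuous_on_const f]) (use max in auto)
        also have "\<dots> \<le> (1 + C / M) * M ^ n"
          using C M by (intro mult_right_mono) auto
        finally show ?thesis using annealed_partition_function_even[OF \<beta> True] by blast
      next
        case False
        then have "odd d" by auto
        then have "circle_mean (\<lambda>\<theta>. site_weight (d + 1) \<beta> B \<theta> * ?f \<theta> ^ (n - 1)) \<le> C * M ^ (n - 1)"
          by (intro circle_mean_power_le[OF continuous_on_site_weight f]) (use max odd_nonneg C in auto)
        also have "\<dots> = C / M * M ^ n" using n M by (cases n) auto
        also have "\<dots> \<le> (1 + C / M) * M ^ n"
          using C M by (intro mult_right_mono) auto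
        finally show ?thesis using annealed_partition_function_odd[OF \<beta> False] by blast
      qed
      then obtain I where I: "?Z n = ?W n * I" "I \<le> (1 + C / M) * M ^ n" by blast
      have "?W n * I \<le> ?W n * ((1 + C / M) * M ^ n)" using I W by (intro mult_left_mono) auto
      also have "\<dots> \<le> (real d + 2) * (real n + 1) * ((1 + C / M) * M ^ n)"
        using W C M by (intro mult_right_mono) auto
      finally show ?thesis by (simp add: I mult_ac)
    qed
    then show "\<forall>\<^sub>F n in sequentially. ?Z n \<le> (real d + 2) * (1 + C / M) * (real n + 1) * M ^ n"
      by (rule eventually_mono[OF eventually_gt_at_top[of 0]])
  qed
qed

section \<open>Differentiability of support functions\<close>

definition support_function :: "'a::real_inner set \<Rightarrow> 'a \<Rightarrow> real" where
  "support_function K \<xi> = (SUP p\<in>K. \<xi> \<bullet> p)"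

lemma support_function_attained:
  assumes "compact K" "K \<noteq> {}"
  obtains p where "p \<in> K" "support_function K \<xi> = \<xi> \<bullet> p" "\<And>q. q \<in> K \<Longrightarrow> \<xi> \<bullet> q \<le> \<xi> \<bullet> p"
proof -
  obtain p where p: "p \<in> K" "\<And>q. q \<in> K \<Longrightarrow> \<xi> \<bullet> q \<le> \<xi> \<bullet> p"
    using continuous_attains_sup[OF assms continuous_on_inner[OF continuous_on_const continuous_on_id]]
    by (metis id_apply)
  then have "support_function K \<xi> = \<xi> \<bullet> p"
    unfolding support_function_def by (intro cSup_eq_maximum) auto
  with p show ?thesis by (intro that)
qed

lemma inner_le_support_function:
  assumes "compact K" "p \<in> K"
  shows "\<xi> \<bullet> p \<le> support_function K \<xi>"
proof -
  have "K \<noteq> {}" using assms(2) by blast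
  then obtain q where "support_function K \<xi> = \<xi> \<bullet> q" "\<And>p. p \<in> K \<Longrightarrow> \<xi> \<bullet> p \<le> \<xi> \<bullet> q"
    using support_function_attained[OF assms(1), of \<xi>] by blast
  then show ?thesis using assms(2) by simp
qed

text \<open>
  If \<open>p\<close> supports at \<open>\<xi>\<close>, then comparing \<open>p\<close> and \<open>p0\<close> in the two directions bounds the remainder of the
  linear approximation between \<open>0\<close> and \<open>(\<xi> - \<xi>0) \<bullet> (p - p0)\<close>. By compactness, \<open>p\<close> tends to the unique
  supporting point \<open>p0\<close> as \<open>\<xi>\<close> tends to \<open>\<xi>0\<close>.
\<close>

lemma support_function_has_derivative:
  fixes K :: "'a::real_inner set"
  assumes K: "compact K" and p0: "p0 \<in> K"
    and unique: "\<And>p. p \<in> K \<Longrightarrow> p \<noteq> p0 \<Longrightarrow> \<xi>0 \<bullet> p < \<xi>0 \<bullet> p0"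
  shows "(support_function K has_derivative (\<lambda>\<zeta>. \<zeta> \<bullet> p0)) (at \<xi>0)"
  unfolding has_derivative_at_alt
proof (intro conjI allI impI)
  have ne: "K \<noteq> {}" using p0 by auto
  note upper = inner_le_support_function[OF K]
  have h0: "support_function K \<xi>0 = \<xi>0 \<bullet> p0"
    using unique p0 by (metis support_function_attained[OF K ne] less_le_not_le)
  show "bounded_linear (\<lambda>\<zeta>. \<zeta> \<bullet> p0)" by (rule bounded_linear_inner_left)
  fix e :: real assume e: "e > 0"
  obtain R where R: "R > 0" "\<And>p. p \<in> K \<Longrightarrow> norm p \<le> R"
    using compact_imp_bounded[OF K] by (auto simp: bounded_pos)
  have cmp: "\<bar>\<xi> \<bullet> p - \<xi>0 \<bullet> p\<bar> \<le> norm (\<xi> - \<xi>0) * R" if "p \<in> K" for \<xi> p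
  proof -
    have "\<bar>\<xi> \<bullet> p - \<xi>0 \<bullet> p\<bar> \<le> norm (\<xi> - \<xi>0) * norm p"
      using Cauchy_Schwarz_ineq2[of "\<xi> - \<xi>0" p] by (simp add: inner_diff_left)
    also have "\<dots> \<le> norm (\<xi> - \<xi>0) * R" using R(2)[OF that] by (intro mult_left_mono) auto
    finally show ?thesis .
  qed
  have "\<exists>\<delta>>0. \<forall>\<xi> p. norm (\<xi> - \<xi>0) < \<delta> \<longrightarrow> p \<in> K \<longrightarrow> support_function K \<xi> = \<xi> \<bullet> p \<longrightarrow> norm (p - p0) \<le> e"
  proof (cases "K - ball p0 e = {}")
    case True
    then show ?thesis
      by (intro exI[of _ 1]) (auto simp: dist_norm norm_minus_commute intro: less_imp_le)
  next
    case False
    have "compact (K - ball p0 e)" using K by (intro compact_diff) auto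
    then obtain q where q: "q \<in> K - ball p0 e" "\<And>p. p \<in> K - ball p0 e \<Longrightarrow> \<xi>0 \<bullet> p \<le> \<xi>0 \<bullet> q"
      by (metis support_function_attained[OF _ False])
    \<comment> \<open>Points of \<open>K\<close> outside the ball lose at least \<open>\<eta>\<close> in direction \<open>\<xi>0\<close>; a small change of direction
      cannot make up for this.\<close>
    define \<eta> where "\<eta> = \<xi>0 \<bullet> p0 - \<xi>0 \<bullet> q"
    have "q \<noteq> p0" using q(1) e by auto
    then have \<eta>: "\<eta> > 0" using unique q(1) by (simp add: \<eta>_def)
    have "norm (p - p0) \<le> e"
      if close: "norm (\<xi> - \<xi>0) < \<eta> / (2 * R)" and p: "p \<in> K" "support_function K \<xi> = \<xi> \<bullet> p" for \<xi> p
    proof (rule ccontr)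
      assume "\<not> norm (p - p0) \<le> e"
      then have "p \<in> K - ball p0 e" using p by (auto simp: dist_norm norm_minus_commute)
      then have "\<xi>0 \<bullet> p \<le> \<xi>0 \<bullet> p0 - \<eta>" using q(2) by (simp add: \<eta>_def)
      moreover have "norm (\<xi> - \<xi>0) * R < \<eta> / 2" using close R(1) by (simp add: field_simps)
      moreover have "\<xi> \<bullet> p0 \<le> \<xi> \<bullet> p" using upper[OF p0, of \<xi>] p by simp
      ultimately show False using cmp[OF p(1), of \<xi>] cmp[OF p0, of \<xi>] by linarith
    qed
    then show ?thesis using \<eta> R by (intro exI[of _ "\<eta> / (2 * R)"]) auto
  qed
  then obtain \<delta> where \<delta>: "\<delta> > 0" "\<And>\<xi> p. norm (\<xi> - \<xi>0) < \<delta> \<Longrightarrow> p \<in> K \<Longrightarrow>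
    support_function K \<xi> = \<xi> \<bullet> p \<Longrightarrow> norm (p - p0) \<le> e" by blast
  have "norm (support_function K \<xi> - support_function K \<xi>0 - (\<xi> - \<xi>0) \<bullet> p0) \<le> e * norm (\<xi> - \<xi>0)"
    if close: "norm (\<xi> - \<xi>0) < \<delta>" for \<xi>
  proof -
    obtain p where p: "p \<in> K" "support_function K \<xi> = \<xi> \<bullet> p"
      by (metis support_function_attained[OF K ne])
    have lo: "0 \<le> support_function K \<xi> - support_function K \<xi>0 - (\<xi> - \<xi>0) \<bullet> p0"
      using upper[OF p0, of \<xi>] by (simp add: h0 inner_diff_left)
    have "support_function K \<xi> - support_function K \<xi>0 - (\<xi> - \<xi>0) \<bullet> p0 \<le> (\<xi> - \<xi>0) \<bullet> (p - p0)"
      using upper[OF p(1), of \<xi>0] by (simp add: p(2) h0 inner_diff_left inner_diff_right)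
    also have "\<dots> \<le> norm (\<xi> - \<xi>0) * norm (p - p0)" by (rule norm_cauchy_schwarz)
    also have "\<dots> \<le> norm (\<xi> - \<xi>0) * e" using \<delta>(2)[OF close p] by (intro mult_left_mono) auto
    finally show ?thesis using lo by (simp add: mult.commute)
  qed
  then show "\<exists>\<delta>>0. \<forall>\<xi>. norm (\<xi> - \<xi>0) < \<delta> \<longrightarrow>
      norm (support_function K \<xi> - support_function K \<xi>0 - (\<xi> - \<xi>0) \<bullet> p0) \<le> e * norm (\<xi> - \<xi>0)"
    using \<delta>(1) by blast
qed

section \<open>The growth rate\<close>

text \<open>
  An upper bound for the modulus of the site weight that does not see the signs of the amplitudes and
  is linear in \<open>(exp B, exp (- B))\<close> with nonnegative coefficients. It has the same maximum.
\<close>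

definition folded_weight :: "nat \<Rightarrow> real \<Rightarrow> real \<Rightarrow> real \<Rightarrow> real" where
  "folded_weight d \<beta> B \<theta> =
     exp B * \<bar>spin_amplitude \<beta> 1 \<theta>\<bar> ^ d + exp (- B) * \<bar>spin_amplitude \<beta> (- 1) \<theta>\<bar> ^ d"

lemma abs_site_weight_le_folded: "\<bar>site_weight d \<beta> B \<theta>\<bar> \<le> folded_weight d \<beta> B \<theta>"
proof -
  have "\<bar>site_weight d \<beta> B \<theta>\<bar> \<le> \<bar>exp B * spin_amplitude \<beta> 1 \<theta> ^ d\<bar> + \<bar>exp (- B) * spin_amplitude \<beta> (- 1) \<theta> ^ d\<bar>"
    unfolding site_weight_def by (rule abs_triangle_ineq)
  then show ?thesis by (simp add: folded_weight_def abs_mult power_abs)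
qed

lemma spin_amplitude_add_pi: "spin_amplitude \<beta> s (\<theta> + pi) = - spin_amplitude \<beta> s \<theta>"
  by (simp add: spin_amplitude_def)

lemma spin_amplitude_minus: "spin_amplitude \<beta> s (- \<theta>) = spin_amplitude \<beta> (- s) \<theta>"
  by (simp add: spin_amplitude_def)

lemma folded_weight_minus: "folded_weight d \<beta> B (- \<theta>) = folded_weight d \<beta> (- B) \<theta>"
  by (simp add: folded_weight_def spin_amplitude_minus)

text \<open>
  If the amplitudes have opposite signs, then \<open>\<bar>cos \<theta>\<bar> < \<bar>sin \<theta>\<bar>\<close>. Exchanging sine and cosine puts the
  larger coordinate on the larger coefficient \<open>sqrt (cosh \<beta>)\<close>, and this increases the modulus of both
  amplitudes.
\<close>

lemma folded_weight_complement:
  assumes \<beta>: "\<beta> \<ge> 0" and d: "d > 0"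
    and neg: "spin_amplitude \<beta> 1 \<theta> * spin_amplitude \<beta> (- 1) \<theta> < 0"
  shows "folded_weight d \<beta> B \<theta> < folded_weight d \<beta> B (pi / 2 - \<theta>)"
proof -
  define a b where "a = sqrt (cosh \<beta>)" and "b = sqrt (sinh \<beta>)"
  define c s where "c = cos \<theta>" and "s = sin \<theta>"
  have ab: "a\<^sup>2 = cosh \<beta>" "b\<^sup>2 = sinh \<beta>"
    using \<beta> cosh_real_pos[of \<beta>] by (simp_all add: a_def b_def)
  have gap: "a\<^sup>2 - b\<^sup>2 > 0" by (simp add: ab cosh_minus_sinh)
  have "(a * c + b * s) * (a * c - b * s) < 0"
    using neg by (simp add: spin_amplitude_def a_def b_def c_def s_def)
  then have "a\<^sup>2 * c\<^sup>2 < b\<^sup>2 * s\<^sup>2" by (simp add: algebra_simps power2_eq_square)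
  also have "\<dots> \<le> a\<^sup>2 * s\<^sup>2" using gap by (intro mult_right_mono) auto
  finally have cs: "c\<^sup>2 < s\<^sup>2" by (simp add: ab)
  have less: "\<bar>spin_amplitude \<beta> r \<theta>\<bar> < \<bar>spin_amplitude \<beta> r (pi / 2 - \<theta>)\<bar>" if r: "r \<in> {-1, 1}" for r
  proof -
    have "(spin_amplitude \<beta> r (pi / 2 - \<theta>))\<^sup>2 - (spin_amplitude \<beta> r \<theta>)\<^sup>2 = (a\<^sup>2 - b\<^sup>2) * (s\<^sup>2 - c\<^sup>2)"
      using r by (auto simp: spin_amplitude_def cos_diff sin_diff a_def[symmetric] b_def[symmetric]
          c_def[symmetric] s_def[symmetric] power2_eq_square algebra_simps)
    also have "\<dots> > 0" using gap cs by simp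
    finally show ?thesis by (simp flip: not_le) (simp add: abs_le_square_iff)
  qed
  show ?thesis
    unfolding folded_weight_def using less d
    by (intro add_strict_mono mult_strict_left_mono power_strict_mono) auto
qed

lemma angle_normalize:
  obtains \<theta>' where "\<theta>' \<in> {0..2 * pi}" "cos \<theta>' = cos \<theta>" "sin \<theta>' = sin \<theta>"
proof -
  have "(cos \<theta>)\<^sup>2 + (sin \<theta>)\<^sup>2 = 1" by simp
  then obtain t where "0 \<le> t" "t < 2 * pi" "cos \<theta> = cos t" "sin \<theta> = sin t"
    by (rule sincos_total_2pi)
  then show ?thesis by (intro that[of t]) auto
qed

text \<open>
  The linear functional \<open>(exp B, exp (- B))\<close> takes the values of the folded weight on this curve, so the
  growth rate is a support function, and its dependence on \<open>B\<close> is confined to the direction.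
\<close>

definition amplitude_curve :: "nat \<Rightarrow> real \<Rightarrow> (real \<times> real) set" where
  "amplitude_curve d \<beta> =
     range (\<lambda>\<theta>. (\<bar>spin_amplitude \<beta> 1 \<theta>\<bar> ^ d, \<bar>spin_amplitude \<beta> (- 1) \<theta>\<bar> ^ d))"

lemma compact_amplitude_curve: "compact (amplitude_curve d \<beta>)"
proof -
  let ?f = "\<lambda>\<theta>. (\<bar>spin_amplitude \<beta> 1 \<theta>\<bar> ^ d, \<bar>spin_amplitude \<beta> (- 1) \<theta>\<bar> ^ d)"
  have "?f \<theta> \<in> ?f ` {0..2 * pi}" for \<theta>
  proof -
    obtain t where "t \<in> {0..2 * pi}" "cos t = cos \<theta>" "sin t = sin \<theta>" by (rule angle_normalize)
    then show ?thesis by (intro image_eqI[of _ _ t]) (auto simp: spin_amplitude_def)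
  qed
  then have "amplitude_curve d \<beta> = ?f ` {0..2 * pi}"
    by (auto simp: amplitude_curve_def)
  moreover have "continuous_on {0..2 * pi} ?f" by (intro continuous_intros)
  ultimately show ?thesis by (simp only: compact_continuous_image compact_Icc)
qed

definition growth_rate :: "nat \<Rightarrow> real \<Rightarrow> real \<Rightarrow> real" where
  "growth_rate d \<beta> B = support_function (amplitude_curve d \<beta>) (exp B, exp (- B))"

lemma folded_weight_eq_inner:
  "folded_weight d \<beta> B \<theta> = (exp B, exp (- B)) \<bullet>
     (\<bar>spin_amplitude \<beta> 1 \<theta>\<bar> ^ d, \<bar>spin_amplitude \<beta> (- 1) \<theta>\<bar> ^ d)"
  by (simp add: folded_weight_def)

lemma growth_rate_attained:
  obtains \<theta> where "\<theta> \<in> {0..2 * pi}" "growth_rate d \<beta> B = folded_weight d \<beta> B \<theta>"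
proof -
  have "amplitude_curve d \<beta> \<noteq> {}" by (simp add: amplitude_curve_def)
  then obtain p where p: "p \<in> amplitude_curve d \<beta>" "growth_rate d \<beta> B = (exp B, exp (- B)) \<bullet> p"
    using support_function_attained[OF compact_amplitude_curve, of d \<beta> "(exp B, exp (- B))"]
    unfolding growth_rate_def by blast
  then obtain \<theta> where \<theta>: "growth_rate d \<beta> B = folded_weight d \<beta> B \<theta>"
    by (auto simp: amplitude_curve_def folded_weight_eq_inner)
  obtain t where "t \<in> {0..2 * pi}" "cos t = cos \<theta>" "sin t = sin \<theta>" by (rule angle_normalize)
  with \<theta> show ?thesis
    by (intro that[of t]) (auto simp: folded_weight_def spin_amplitude_def)
qed

lemma folded_weight_le_growth_rate: "folded_weight d \<beta> B \<theta> \<le> growth_rate d \<beta> B"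
  unfolding folded_weight_eq_inner growth_rate_def
  by (rule inner_le_support_function[OF compact_amplitude_curve]) (simp add: amplitude_curve_def)

lemma growth_rate_pos: "growth_rate d \<beta> B > 0"
proof -
  have "0 < folded_weight d \<beta> B 0"
    using cosh_real_pos[of \<beta>]
    by (auto simp: folded_weight_def spin_amplitude_def intro!: add_pos_pos mult_pos_pos)
  then show ?thesis using folded_weight_le_growth_rate by (rule less_le_trans)
qed

lemma growth_rate_minus: "growth_rate d \<beta> (- B) = growth_rate d \<beta> B"
proof -
  have "growth_rate d \<beta> (- B) \<le> growth_rate d \<beta> B" for B
  proof -
    obtain \<theta> where "growth_rate d \<beta> (- B) = folded_weight d \<beta> (- B) \<theta>" by (rule growth_rate_attained)
    also have "\<dots> = folded_weight d \<beta> B (- \<theta>)" by (simp add: folded_weight_minus)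
    also have "\<dots> \<le> growth_rate d \<beta> B" by (rule folded_weight_le_growth_rate)
    finally show ?thesis .
  qed
  from this[of B] this[of "- B"] show ?thesis by simp
qed

text \<open>
  The fields \<open>B\<close> and \<open>- B\<close> have the same growth rate, and the average of their weights is the zero-field
  weight multiplied by \<open>cosh B \<ge> 1\<close>.
\<close>

lemma growth_rate_ge_zero_field: "growth_rate d \<beta> 0 \<le> growth_rate d \<beta> B"
proof -
  obtain \<theta> where \<theta>: "growth_rate d \<beta> 0 = folded_weight d \<beta> 0 \<theta>" by (rule growth_rate_attained)
  have "2 * folded_weight d \<beta> 0 \<theta> \<le> (exp B + exp (- B)) * folded_weight d \<beta> 0 \<theta>"
  proof (rule mult_right_mono)
    show "2 \<le> exp B + exp (- B)"
      using cosh_real_ge_1[of B] by (simp add: cosh_field_def)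
  qed (simp add: folded_weight_def)
  also have "\<dots> = folded_weight d \<beta> B \<theta> + folded_weight d \<beta> (- B) \<theta>"
    unfolding folded_weight_def by (simp add: distrib_left distrib_right)
  also have "\<dots> \<le> 2 * growth_rate d \<beta> B"
    using folded_weight_le_growth_rate[of d \<beta> B \<theta>] folded_weight_le_growth_rate[of d \<beta> B "- \<theta>"]
    by (simp add: folded_weight_minus)
  finally show ?thesis using \<theta> by simp
qed

lemma maximizer_same_sign:
  assumes "\<beta> \<ge> 0" "d > 0" "folded_weight d \<beta> B \<theta> = growth_rate d \<beta> B"
  shows "spin_amplitude \<beta> 1 \<theta> * spin_amplitude \<beta> (- 1) \<theta> \<ge> 0"
  using folded_weight_complement[OF assms(1,2), of \<theta> B] assms(3)
    folded_weight_le_growth_rate[of d \<beta> B "pi / 2 - \<theta>"] by linarith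

lemma abs_site_weight_eq_folded:
  assumes "spin_amplitude \<beta> 1 \<theta> * spin_amplitude \<beta> (- 1) \<theta> \<ge> 0"
  shows "\<bar>site_weight d \<beta> B \<theta>\<bar> = folded_weight d \<beta> B \<theta>"
proof (cases "spin_amplitude \<beta> 1 \<theta> \<ge> 0 \<and> spin_amplitude \<beta> (- 1) \<theta> \<ge> 0")
  case True
  then show ?thesis by (simp add: site_weight_def folded_weight_def)
next
  case False
  then have neg: "spin_amplitude \<beta> 1 \<theta> \<le> 0" "spin_amplitude \<beta> (- 1) \<theta> \<le> 0"
    using assms by (auto simp: zero_le_mult_iff)
  have "site_weight d \<beta> B \<theta> = (- 1) ^ d * folded_weight d \<beta> B \<theta>"
    using neg by (simp add: site_weight_def folded_weight_def algebra_simps flip: power_mult_distrib)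
  then show ?thesis by (simp add: abs_mult power_abs folded_weight_def)
qed

text \<open>
  The folded weight attains its maximum at an angle where the amplitudes do not have opposite signs. No
  cancellation takes place there, so the site weight itself has this modulus.
\<close>

lemma pressure_limit:
  assumes "\<beta> \<ge> 0" "d > 0"
  shows "(\<lambda>n. ln (annealed_partition_function d n \<beta> B) / real n) \<longlonglongrightarrow> ln (growth_rate d \<beta> B)"
proof -
  obtain \<theta> where \<theta>: "\<theta> \<in> {0..2 * pi}" "growth_rate d \<beta> B = folded_weight d \<beta> B \<theta>"
    by (rule growth_rate_attained)
  show ?thesis
  proof (rule pressure_limit_of_max[OF assms \<theta>(1) _ growth_rate_pos])
    show "\<bar>site_weight d \<beta> B \<theta>\<bar> = growth_rate d \<beta> B"
      using abs_site_weight_eq_folded maximizer_same_sign[OF assms] \<theta>(2) by metis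
    show "\<bar>site_weight d \<beta> B \<theta>\<bar> \<le> growth_rate d \<beta> B" for \<theta>
      using abs_site_weight_le_folded folded_weight_le_growth_rate by (rule order_trans)
  qed
qed

section \<open>Uniqueness of the maximizer in a positive field\<close>

text \<open>
  The sign of the derivative of \<open>F\<close> is governed by an affine function of \<open>t\<^sup>2\<close> with positive slope, so \<open>F\<close>
  stops increasing at most once and decreases strictly afterwards. It starts at \<open>F 0 = 2 * B > 0\<close>. At
  the first zero it must already be decreasing, so a second zero is impossible.
\<close>

lemma bethe_equation_unique:
  fixes l B t\<^sub>1 t\<^sub>2 m :: real
  assumes l: "0 < l" "l < 1" and m: "m \<ge> 1" and B: "B > 0"
    and t: "0 < t\<^sub>1" "t\<^sub>1 < t\<^sub>2" "t\<^sub>2 < l"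
  defines "F \<equiv> \<lambda>t. 2 * B + m * (ln (1 + l * t) - ln (1 - l * t)) - (ln (l + t) - ln (l - t))"
  assumes "F t\<^sub>1 = 0" "F t\<^sub>2 = 0"
  shows False
proof -
  define F' where "F' t = m * (l / (1 + l * t) + l / (1 - l * t)) - (1 / (l + t) + 1 / (l - t))" for t
  have lt: "l * t < 1" if "0 \<le> t" "t < l" for t
  proof -
    have "l * t \<le> l * l" using that l by (intro mult_left_mono) auto
    also have "\<dots> < 1" using l mult_strict_mono[of l 1 l 1] by simp
    finally show ?thesis .
  qed
  have deriv: "(F has_real_derivative F' t) (at t)" if "0 \<le> t" "t < l" for t
  proof -
    have "1 + l * t > 0" using that l by (intro add_pos_nonneg) auto
    then show ?thesis unfolding F_def F'_def using that l lt[OF that]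
      by (auto intro!: derivative_eq_intros simp: divide_inverse)
  qed
  have sign: "F' t < 0 \<longleftrightarrow> m * l\<^sup>2 - 1 < (m - l\<^sup>2) * t\<^sup>2" if "0 \<le> t" "t < l" for t
  proof -
    have pos: "1 + l * t > 0" "1 - l * t > 0" "l + t > 0" "l - t > 0"
      using that l lt[OF that] by (auto intro: add_pos_nonneg)
    have "l / (1 + l * t) + l / (1 - l * t) = 2 * l / ((1 + l * t) * (1 - l * t))"
      using pos by (simp add: field_simps)
    moreover have "1 / (l + t) + 1 / (l - t) = 2 * l / ((l + t) * (l - t))"
      using pos by (simp add: field_simps)
    moreover define P Q where "P = (1 + l * t) * (1 - l * t)" and "Q = (l + t) * (l - t)"
    moreover have PQ: "P > 0" "Q > 0" using pos by (simp_all add: P_def Q_def)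
    ultimately have "F' t = m * (2 * l / P) - 2 * l / Q" by (simp only: F'_def)
    also have "\<dots> = 2 * l * (m * Q - P) / (P * Q)" using PQ by (simp add: field_simps)
    finally have "F' t < 0 \<longleftrightarrow> m * Q < P"
      using PQ l by (simp add: divide_less_0_iff mult_less_0_iff zero_less_mult_iff)
    also have "\<dots> \<longleftrightarrow> m * ((l + t) * (l - t)) < (1 + l * t) * (1 - l * t)"
      by (simp add: P_def Q_def)
    also have "\<dots> \<longleftrightarrow> m * l\<^sup>2 - 1 < (m - l\<^sup>2) * t\<^sup>2"
      by (simp add: algebra_simps power2_eq_square)
    finally show ?thesis .
  qed
  obtain x where x: "0 < x" "x < t\<^sub>1" "F t\<^sub>1 - F 0 = (t\<^sub>1 - 0) * F' x"
    using MVT2[of 0 t\<^sub>1 F F'] t deriv by auto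
  have "F 0 = 2 * B" by (simp add: F_def)
  then have "t\<^sub>1 * F' x < 0" using x(3) assms(9) B by simp
  then have x': "F' x < 0" using t by (simp add: mult_less_0_iff)
  obtain y where y: "t\<^sub>1 < y" "y < t\<^sub>2" "F t\<^sub>2 - F t\<^sub>1 = (t\<^sub>2 - t\<^sub>1) * F' y"
    using MVT2[of t\<^sub>1 t\<^sub>2 F F'] t deriv by auto
  have l2: "l\<^sup>2 < 1" using l by (simp add: abs_square_less_1)
  have "m * l\<^sup>2 - 1 < (m - l\<^sup>2) * x\<^sup>2" using sign[of x] x x' t by auto
  also have "(m - l\<^sup>2) * x\<^sup>2 \<le> (m - l\<^sup>2) * y\<^sup>2"
    using m x y l2 by (intro mult_left_mono power_mono) auto
  finally have "F' y < 0" using sign[of y] y t by auto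
  then show False using y assms(9,10) by simp
qed

text \<open>
  Where both amplitudes are nonnegative the site weight equals the folded weight, so at a maximizer the
  smooth function \<open>site_weight\<close> has a global maximum, even if the folded weight is not differentiable.
\<close>

lemma maximizer_critical:
  assumes \<beta>: "\<beta> \<ge> 0" and d: "d > 0"
    and max: "folded_weight d \<beta> B \<theta> = growth_rate d \<beta> B"
    and nonneg: "spin_amplitude \<beta> 1 \<theta> \<ge> 0" "spin_amplitude \<beta> (- 1) \<theta> \<ge> 0"
  shows "exp B * spin_amplitude \<beta> 1 \<theta> ^ (d - 1) * (sqrt (sinh \<beta>) * cos \<theta> - sqrt (cosh \<beta>) * sin \<theta>) =
    exp (- B) * spin_amplitude \<beta> (- 1) \<theta> ^ (d - 1) * (sqrt (sinh \<beta>) * cos \<theta> + sqrt (cosh \<beta>) * sin \<theta>)"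
proof -
  let ?D = "\<lambda>s. s * sqrt (sinh \<beta>) * cos \<theta> - sqrt (cosh \<beta>) * sin \<theta>"
  have "site_weight d \<beta> B x \<le> site_weight d \<beta> B \<theta>" for x
  proof -
    have "site_weight d \<beta> B x \<le> growth_rate d \<beta> B"
      using abs_site_weight_le_folded[of d \<beta> B x] folded_weight_le_growth_rate[of d \<beta> B x] by linarith
    also have "\<dots> = site_weight d \<beta> B \<theta>"
      unfolding max[symmetric] using nonneg by (simp add: site_weight_def folded_weight_def)
    finally show ?thesis .
  qed
  moreover have "(site_weight d \<beta> B has_real_derivative
      exp B * (real d * spin_amplitude \<beta> 1 \<theta> ^ (d - 1) * ?D 1) +
      exp (- B) * (real d * spin_amplitude \<beta> (- 1) \<theta> ^ (d - 1) * ?D (- 1))) (at \<theta>)"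
    unfolding site_weight_def
    by (auto intro!: derivative_eq_intros spin_amplitude_deriv)
  ultimately have "exp B * (real d * spin_amplitude \<beta> 1 \<theta> ^ (d - 1) * ?D 1) +
      exp (- B) * (real d * spin_amplitude \<beta> (- 1) \<theta> ^ (d - 1) * ?D (- 1)) = 0"
    by (intro DERIV_local_max[of _ _ _ 1]) auto
  then have "real d * (exp B * spin_amplitude \<beta> 1 \<theta> ^ (d - 1) * ?D 1 +
      exp (- B) * spin_amplitude \<beta> (- 1) \<theta> ^ (d - 1) * ?D (- 1)) = 0" by (simp add: algebra_simps)
  then have "exp B * spin_amplitude \<beta> 1 \<theta> ^ (d - 1) * ?D 1 +
      exp (- B) * spin_amplitude \<beta> (- 1) \<theta> ^ (d - 1) * ?D (- 1) = 0" using d by simp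
  then show ?thesis by (simp add: algebra_simps)
qed

text \<open>
  The condition that the derivative vanishes, written in terms of \<open>t = tan \<theta>\<close>, is
  \<open>exp B * (1 + l * t) ^ (d - 1) * (l - t) = exp (- B) * (1 - l * t) ^ (d - 1) * (l + t)\<close>. With
  \<open>l * t = tanh h\<close> this reads \<open>tanh h = tanh \<beta> * tanh (B + (d - 1) * h)\<close>, the recursion on the
  regular tree. Its logarithm is available once \<open>0 < t < l\<close> is known. For \<open>\<beta> = 0\<close> one has \<open>l = 0\<close>, and
  the equation forces \<open>t = 0\<close>.
\<close>

lemma maximizer_fixed_point:
  assumes \<beta>: "\<beta> \<ge> 0" and d: "d \<ge> 2" and B: "B > 0"
    and max: "folded_weight d \<beta> B \<theta> = growth_rate d \<beta> B"
    and nonneg: "spin_amplitude \<beta> 1 \<theta> \<ge> 0" "spin_amplitude \<beta> (- 1) \<theta> \<ge> 0"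
  defines "l \<equiv> sqrt (tanh \<beta>)" and "t \<equiv> tan \<theta>"
  shows "cos \<theta> > 0"
    and "\<beta> = 0 \<and> t = 0 \<or> 0 < l \<and> l < 1 \<and> 0 < t \<and> t < l \<and>
      2 * B + (real d - 1) * (ln (1 + l * t) - ln (1 - l * t)) - (ln (l + t) - ln (l - t)) = 0"
proof -
  define a b where "a = sqrt (cosh \<beta>)" and "b = sqrt (sinh \<beta>)"
  define c s where "c = cos \<theta>" and "s = sin \<theta>"
  have a: "a > 0" using cosh_real_pos[of \<beta>] by (simp add: a_def)
  have l0: "l \<ge> 0" "l < 1" using \<beta> tanh_real_lt_1[of \<beta>] by (simp_all add: l_def)
  have b: "b = a * l" using cosh_real_pos[of \<beta>]
    by (simp add: a_def b_def l_def tanh_def real_sqrt_divide)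
  have uv: "spin_amplitude \<beta> 1 \<theta> = a * c + b * s" "spin_amplitude \<beta> (- 1) \<theta> = a * c - b * s"
    by (simp_all add: spin_amplitude_def a_def b_def c_def s_def)
  have "a * c \<ge> 0" using nonneg uv by linarith
  moreover have "c \<noteq> 0"
  proof
    assume "c = 0"
    then have "b * s = 0" using nonneg uv by auto
    then have "spin_amplitude \<beta> 1 \<theta> = 0" "spin_amplitude \<beta> (- 1) \<theta> = 0" using \<open>c = 0\<close> uv by auto
    then have "folded_weight d \<beta> B \<theta> = 0" using d by (simp add: folded_weight_def zero_power)
    then show False using growth_rate_pos[of d \<beta> B] max by simp
  qed
  ultimately have c: "c > 0" using a by (simp add: zero_le_mult_iff)
  then show "cos \<theta> > 0" by (simp add: c_def)
  have s: "s = t * c" using c by (simp add: t_def tan_def c_def s_def)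
  have u: "a * c + b * s = a * c * (1 + l * t)" and v: "a * c - b * s = a * c * (1 - l * t)"
    by (simp_all add: b s algebra_simps)
  have ac: "a * c > 0" using a c by simp
  have lt: "1 - l * t \<ge> 0" using nonneg(2) ac unfolding uv v by (simp add: zero_le_mult_iff)
  let ?k = "d - 1"
  have "exp B * (a * c * (1 + l * t)) ^ ?k * (a * c * (l - t)) =
      exp (- B) * (a * c * (1 - l * t)) ^ ?k * (a * c * (l + t))"
  proof -
    have "b * c - a * s = a * c * (l - t)" "b * c + a * s = a * c * (l + t)"
      by (simp_all add: b s algebra_simps)
    then show ?thesis
      using maximizer_critical[OF \<beta> _ max nonneg] d unfolding uv u v
      by (simp add: a_def[symmetric] b_def[symmetric] c_def[symmetric] s_def[symmetric])
  qed
  then have "(a * c) ^ ?k * (a * c) * (exp B * (1 + l * t) ^ ?k * (l - t)) =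
      (a * c) ^ ?k * (a * c) * (exp (- B) * (1 - l * t) ^ ?k * (l + t))"
    by (simp only: power_mult_distrib mult_ac)
  moreover have "(a * c) ^ ?k * (a * c) \<noteq> 0" using ac by (intro no_zero_divisors power_not_zero) auto
  ultimately have crit: "exp B * (1 + l * t) ^ ?k * (l - t) = exp (- B) * (1 - l * t) ^ ?k * (l + t)"
    by (rule mult_left_cancel[THEN iffD1, rotated])
  show "\<beta> = 0 \<and> t = 0 \<or> 0 < l \<and> l < 1 \<and> 0 < t \<and> t < l \<and>
      2 * B + (real d - 1) * (ln (1 + l * t) - ln (1 - l * t)) - (ln (l + t) - ln (l - t)) = 0"
  proof (cases "\<beta> = 0")
    case True
    then have "(exp B + exp (- B)) * t = 0" using crit by (simp add: l_def algebra_simps)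
    moreover have "exp B + exp (- B) > 0" by (intro add_pos_pos) auto
    ultimately show ?thesis using True by simp
  next
    case False
    then have l: "l > 0" using \<beta> by (simp add: l_def)
    \<comment> \<open>A positive field prefers the larger amplitude to be that of spin \<open>+1\<close>; otherwise the reflection
      \<open>\<theta> \<mapsto> - \<theta>\<close>, which exchanges the two amplitudes, would increase the weight.\<close>
    have t0: "t \<ge> 0"
    proof (rule ccontr)
      assume "\<not> t \<ge> 0"
      then have "l * t < 0" using l by (simp add: mult_less_0_iff)
      then have "a * c * (1 + l * t) < a * c * (1 - l * t)" using ac by (intro mult_strict_left_mono) auto
      then have less: "\<bar>spin_amplitude \<beta> 1 \<theta>\<bar> ^ d < \<bar>spin_amplitude \<beta> (- 1) \<theta>\<bar> ^ d"
        using nonneg d unfolding uv u v by (intro power_strict_mono) auto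
      have "0 < (exp B - exp (- B)) * (\<bar>spin_amplitude \<beta> (- 1) \<theta>\<bar> ^ d - \<bar>spin_amplitude \<beta> 1 \<theta>\<bar> ^ d)"
        using B less by (intro mult_pos_pos) auto
      also have "\<dots> = folded_weight d \<beta> B (- \<theta>) - folded_weight d \<beta> B \<theta>"
        unfolding folded_weight_minus unfolding folded_weight_def minus_minus
        by (simp only: left_diff_distrib right_diff_distrib)
      finally show False using max folded_weight_le_growth_rate[of d \<beta> B "- \<theta>"] by linarith
    qed
    have p1: "1 + l * t > 0" using l t0 by (intro add_pos_nonneg) auto
    have "t \<noteq> 0"
    proof
      assume "t = 0"
      then show False using crit l B by simp
    qed
    then have t: "t > 0" using t0 by simp
    \<comment> \<open>Otherwise the left side of the equation is at most \<open>0\<close> and the right side at least \<open>0\<close>, so both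
      vanish, which gives \<open>t = l\<close> and \<open>l * t = 1\<close>.\<close>
    have tl: "t < l"
    proof (rule ccontr)
      assume "\<not> t < l"
      then have "exp B * (1 + l * t) ^ ?k * (l - t) \<le> 0"
        using p1 by (intro mult_nonneg_nonpos) auto
      then have "exp (- B) * (1 - l * t) ^ ?k * (l + t) \<le> 0" using crit by simp
      then have "(1 - l * t) ^ ?k \<le> 0" using l t by (simp add: mult_le_0_iff)
      then have "(1 - l * t) = 0" using lt by (metis zero_less_power less_le not_le)
      then have "exp B * (1 + l * t) ^ ?k * (l - t) = 0" using crit d by (simp add: zero_power)
      then have "l = t" using p1 by simp
      then have "l * l = 1" using \<open>1 - l * t = 0\<close> by simp
      then show False using l0 l mult_strict_mono[of l 1 l 1] by simp
    qed
    have "l * t < 1 * 1" using l0 l t tl by (intro mult_strict_mono) auto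
    then have p2: "1 - l * t > 0" by simp
    have "ln (exp B * (1 + l * t) ^ ?k * (l - t)) = B + real ?k * ln (1 + l * t) + ln (l - t)"
      using p1 tl by (simp add: ln_mult ln_realpow)
    moreover have "ln (exp (- B) * (1 - l * t) ^ ?k * (l + t)) = - B + real ?k * ln (1 - l * t) + ln (l + t)"
      using p2 l t by (simp add: ln_mult ln_realpow)
    ultimately have "B + real ?k * ln (1 + l * t) + ln (l - t) = - B + real ?k * ln (1 - l * t) + ln (l + t)"
      using crit by simp
    moreover have "real ?k = real d - 1" using d by (simp add: of_nat_diff)
    ultimately show ?thesis using l l0 t tl by (simp add: algebra_simps)
  qed
qed

text \<open>
  The fixed point equation determines \<open>tan \<theta>\<close>, and together with \<open>cos \<theta> > 0\<close> this determines the point on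
  the circle. Opposite points have amplitudes of equal modulus.
\<close>

lemma maximizer_unique:
  assumes \<beta>: "\<beta> \<ge> 0" and d: "d \<ge> 2" and B: "B > 0"
    and max: "folded_weight d \<beta> B \<theta>\<^sub>1 = growth_rate d \<beta> B" "folded_weight d \<beta> B \<theta>\<^sub>2 = growth_rate d \<beta> B"
    and s: "s \<in> {-1, 1}"
  shows "\<bar>spin_amplitude \<beta> s \<theta>\<^sub>1\<bar> = \<bar>spin_amplitude \<beta> s \<theta>\<^sub>2\<bar>"
proof -
  \<comment> \<open>A half turn changes the sign of both amplitudes, so both may be taken nonnegative.\<close>
  have positive_rep: "\<exists>\<theta>'. spin_amplitude \<beta> 1 \<theta>' \<ge> 0 \<and> spin_amplitude \<beta> (- 1) \<theta>' \<ge> 0 \<and>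
      (\<forall>s. \<bar>spin_amplitude \<beta> s \<theta>'\<bar> = \<bar>spin_amplitude \<beta> s \<theta>\<bar>)"
    if "folded_weight d \<beta> B \<theta> = growth_rate d \<beta> B" for \<theta>
  proof (cases "spin_amplitude \<beta> 1 \<theta> \<ge> 0 \<and> spin_amplitude \<beta> (- 1) \<theta> \<ge> 0")
    case False
    then have "spin_amplitude \<beta> 1 \<theta> \<le> 0 \<and> spin_amplitude \<beta> (- 1) \<theta> \<le> 0"
      using maximizer_same_sign[OF \<beta> _ that] d by (auto simp: zero_le_mult_iff)
    then show ?thesis by (intro exI[of _ "\<theta> + pi"]) (simp add: spin_amplitude_add_pi)
  qed auto
  obtain x1 where x1: "spin_amplitude \<beta> 1 x1 \<ge> 0" "spin_amplitude \<beta> (- 1) x1 \<ge> 0"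
    "\<And>s. \<bar>spin_amplitude \<beta> s x1\<bar> = \<bar>spin_amplitude \<beta> s \<theta>\<^sub>1\<bar>" using positive_rep[OF max(1)] by blast
  obtain x2 where x2: "spin_amplitude \<beta> 1 x2 \<ge> 0" "spin_amplitude \<beta> (- 1) x2 \<ge> 0"
    "\<And>s. \<bar>spin_amplitude \<beta> s x2\<bar> = \<bar>spin_amplitude \<beta> s \<theta>\<^sub>2\<bar>" using positive_rep[OF max(2)] by blast
  have max': "folded_weight d \<beta> B x1 = growth_rate d \<beta> B" "folded_weight d \<beta> B x2 = growth_rate d \<beta> B"
    using max x1(3) x2(3) by (simp_all add: folded_weight_def)
  note fp1 = maximizer_fixed_point[OF \<beta> d B max'(1) x1(1,2)]
  note fp2 = maximizer_fixed_point[OF \<beta> d B max'(2) x2(1,2)]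
  have m: "real d - 1 \<ge> 1" using d by simp
  have tan: "tan x1 = tan x2"
  proof (cases "\<beta> = 0")
    case True
    then show ?thesis using fp1(2) fp2(2) by simp
  next
    case False
    show ?thesis
    proof (rule linorder_cases[of "tan x1" "tan x2"])
      assume "tan x1 < tan x2"
      then show ?thesis
        using bethe_equation_unique[of "sqrt (tanh \<beta>)" "real d - 1" B "tan x1" "tan x2"] fp1(2) fp2(2) m B False
        by blast
    next
      assume "tan x2 < tan x1"
      then show ?thesis
        using bethe_equation_unique[of "sqrt (tanh \<beta>)" "real d - 1" B "tan x2" "tan x1"] fp1(2) fp2(2) m B False
        by blast
    qed
  qed
  have cos2: "(cos x)\<^sup>2 * (1 + (tan x)\<^sup>2) = 1" if "cos x > 0" for x :: real
    using that sin_cos_squared_add2[of x] by (simp add: tan_def field_simps)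
  have "(cos x1)\<^sup>2 = (cos x2)\<^sup>2"
  proof -
    have "1 + (tan x2)\<^sup>2 > 0" by (intro add_pos_nonneg) auto
    moreover have "(cos x1)\<^sup>2 * (1 + (tan x2)\<^sup>2) = (cos x2)\<^sup>2 * (1 + (tan x2)\<^sup>2)"
      using cos2[OF fp1(1)] cos2[OF fp2(1)] tan by simp
    ultimately show ?thesis by simp
  qed
  then have cos: "cos x1 = cos x2" using fp1(1) fp2(1) by simp
  moreover have "sin x1 = sin x2"
    using tan cos fp1(1) fp2(1) by (simp add: tan_def)
  ultimately have "spin_amplitude \<beta> s x1 = spin_amplitude \<beta> s x2" by (simp add: spin_amplitude_def)
  then show ?thesis using x1(3) x2(3) by metis
qed

section \<open>Differentiability of the growth rate\<close>

text \<open>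
  Uniqueness of the two moduli at a maximizer means that the supporting point of the curve is unique.
\<close>

lemma growth_rate_differentiable_pos:
  assumes "\<beta> \<ge> 0" "d \<ge> 2" "B > 0"
  shows "growth_rate d \<beta> differentiable (at B)"
proof -
  obtain \<theta> where \<theta>: "growth_rate d \<beta> B = folded_weight d \<beta> B \<theta>" by (rule growth_rate_attained)
  define point where "point x = (\<bar>spin_amplitude \<beta> 1 x\<bar> ^ d, \<bar>spin_amplitude \<beta> (- 1) x\<bar> ^ d)" for x
  have inner: "folded_weight d \<beta> B x = (exp B, exp (- B)) \<bullet> point x" for x
    by (simp add: folded_weight_def point_def)
  have "(support_function (amplitude_curve d \<beta>) has_derivative (\<lambda>\<zeta>. \<zeta> \<bullet> point \<theta>)) (at (exp B, exp (- B)))"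
  proof (rule support_function_has_derivative[OF compact_amplitude_curve])
    show "point \<theta> \<in> amplitude_curve d \<beta>" by (simp add: amplitude_curve_def point_def)
    fix p assume "p \<in> amplitude_curve d \<beta>" "p \<noteq> point \<theta>"
    then obtain x where x: "p = point x" "point x \<noteq> point \<theta>" by (auto simp: amplitude_curve_def point_def)
    then have "folded_weight d \<beta> B x \<noteq> growth_rate d \<beta> B"
      using maximizer_unique[OF assms _ \<theta>[symmetric]] by (auto simp: point_def)
    then show "(exp B, exp (- B)) \<bullet> p < (exp B, exp (- B)) \<bullet> point \<theta>"
      unfolding x(1) using folded_weight_le_growth_rate[of d \<beta> B x] \<theta> by (simp add: inner)
  qed
  moreover have "((\<lambda>B. (exp B, exp (- B))) has_derivative (\<lambda>h. (h * exp B, - (h * exp (- B))))) (at B)"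
    by (auto intro!: derivative_eq_intros)
  ultimately have "(support_function (amplitude_curve d \<beta>) \<circ> (\<lambda>B. (exp B, exp (- B))) has_derivative
      (\<lambda>\<zeta>. \<zeta> \<bullet> point \<theta>) \<circ> (\<lambda>h. (h * exp B, - (h * exp (- B))))) (at B)"
    using diff_chain_at by blast
  moreover have "support_function (amplitude_curve d \<beta>) \<circ> (\<lambda>B. (exp B, exp (- B))) = growth_rate d \<beta>"
    by (auto simp: growth_rate_def)
  ultimately show ?thesis unfolding differentiable_def by auto
qed

lemma log_growth_rate_differentiable:
  assumes "\<beta> \<ge> 0" "d \<ge> 2" "B \<noteq> 0"
  shows "\<exists>D. ((\<lambda>B. ln (growth_rate d \<beta> B)) has_real_derivative D) (at B)"
proof -
  have pos: "\<exists>D. (growth_rate d \<beta> has_real_derivative D) (at B)" if "B > 0" for B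
    using growth_rate_differentiable_pos[OF assms(1,2) that] by (simp add: real_differentiable_def)
  have "\<exists>D. (growth_rate d \<beta> has_real_derivative D) (at B)"
  proof (cases "B > 0")
    case False
    then obtain D where "(growth_rate d \<beta> has_real_derivative D) (at (- B))"
      using pos[of "- B"] assms(3) by auto
    then have "((\<lambda>x. growth_rate d \<beta> (- x)) has_real_derivative D * (- 1)) (at B)"
      by (rule DERIV_chain2) (auto intro!: derivative_eq_intros)
    then show ?thesis by (auto simp: growth_rate_minus)
  qed (rule pos)
  then show ?thesis using growth_rate_pos[of d \<beta> B] by (auto intro!: derivative_eq_intros)
qed

section \<open>The annealed measures as an exponential family\<close>

lemma space_annealed_measure: "space (annealed_measure d n \<beta> B) = spin_configs n"
  by (simp add: annealed_measure_def space_point_measure)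

lemma annealed_partition_function_pos: "annealed_partition_function d n \<beta> B > 0"
  unfolding annealed_partition_function_weight
  by (intro sum_pos finite_spin_configs mult_pos_pos annealed_weight_pos)
    (auto simp: spin_configs_def PiE_eq_empty_iff)

lemma measure_annealed_measure:
  "\<P>(\<sigma> in annealed_measure d n \<beta> B. Q \<sigma>) =
     (\<Sum>\<sigma>\<in>{\<sigma> \<in> spin_configs n. Q \<sigma>}. annealed_weight d n \<beta> \<sigma> * exp (B * total_spin n \<sigma>)) /
     annealed_partition_function d n \<beta> B"
proof -
  have "{\<sigma> \<in> spin_configs n. Q \<sigma>} \<subseteq> spin_configs n" by blast
  then show ?thesis
    unfolding space_annealed_measure
    unfolding annealed_measure_def boltzmann_expectation_eq
    using annealed_weight_pos annealed_partition_function_pos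
    by (subst measure_def, subst emeasure_point_measure_finite)
       (simp_all add: finite_spin_configs sum_ennreal less_imp_le sum_nonneg sum_divide_distrib)
qed

lemma finite_magnetization_eq:
  "finite_magnetization d n \<beta> B =
     (\<Sum>\<sigma>\<in>spin_configs n. annealed_weight d n \<beta> \<sigma> * exp (B * total_spin n \<sigma>) * total_spin n \<sigma>) /
     annealed_partition_function d n \<beta> B / real n"
  unfolding finite_magnetization_def annealed_measure_def boltzmann_expectation_eq
  using annealed_weight_pos annealed_partition_function_pos
  by (subst lebesgue_integral_point_measure_finite)
     (simp_all add: finite_spin_configs less_imp_le sum_divide_distrib)

definition finite_pressure :: "nat \<Rightarrow> nat \<Rightarrow> real \<Rightarrow> real \<Rightarrow> real" where
  "finite_pressure d n \<beta> B = ln (annealed_partition_function d n \<beta> B) / real n"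

text \<open>
  Jensen's inequality for the exponential function under the annealed measure, with \<open>\<mu>\<close> the mean of
  \<open>(B' - B)\<close> times the total spin. It is obtained by integrating \<open>exp \<mu> * (1 + x - \<mu>) \<le> exp x\<close>.
\<close>

lemma finite_pressure_tangent:
  assumes n: "n > 0"
  shows "finite_pressure d n \<beta> B' \<ge>
    finite_pressure d n \<beta> B + (B' - B) * finite_magnetization d n \<beta> B"
proof -
  let ?Z = "annealed_partition_function d n \<beta>"
  let ?S = "total_spin n" and ?w = "\<lambda>\<sigma>. annealed_weight d n \<beta> \<sigma> * exp (B * total_spin n \<sigma>)"
  define \<mu> where "\<mu> = (B' - B) * (real n * finite_magnetization d n \<beta> B)"
  have Z: "?Z B > 0" "?Z B' > 0" by (rule annealed_partition_function_pos)+
  have mean: "(\<Sum>\<sigma>\<in>spin_configs n. ?w \<sigma> * ?S \<sigma>) = ?Z B * (real n * finite_magnetization d n \<beta> B)"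
    using n Z by (simp add: finite_magnetization_eq)
  have "?Z B * exp \<mu> = exp \<mu> * (\<Sum>\<sigma>\<in>spin_configs n. ?w \<sigma> * (1 + (B' - B) * ?S \<sigma> - \<mu>))"
  proof -
    have "(\<Sum>\<sigma>\<in>spin_configs n. ?w \<sigma> * (1 + (B' - B) * ?S \<sigma> - \<mu>)) =
        (\<Sum>\<sigma>\<in>spin_configs n. ?w \<sigma> * (1 - \<mu>) + (B' - B) * (?w \<sigma> * ?S \<sigma>))"
      by (intro sum.cong refl) (simp add: algebra_simps)
    also have "\<dots> = (\<Sum>\<sigma>\<in>spin_configs n. ?w \<sigma>) * (1 - \<mu>) + (B' - B) * (\<Sum>\<sigma>\<in>spin_configs n. ?w \<sigma> * ?S \<sigma>)"
      by (simp add: sum.distrib sum_distrib_left sum_distrib_right)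
    also have "\<dots> = ?Z B * (1 - \<mu>) + ?Z B * \<mu>"
      unfolding mean by (simp add: annealed_partition_function_weight \<mu>_def)
    finally show ?thesis by (simp add: algebra_simps)
  qed
  also have "\<dots> \<le> (\<Sum>\<sigma>\<in>spin_configs n. annealed_weight d n \<beta> \<sigma> * exp (B' * ?S \<sigma>))"
    unfolding sum_distrib_left
  proof (intro sum_mono)
    fix \<sigma>
    have "1 + (B' - B) * ?S \<sigma> - \<mu> \<le> exp ((B' - B) * ?S \<sigma> - \<mu>)"
      using exp_ge_add_one_self[of "(B' - B) * ?S \<sigma> - \<mu>"] by linarith
    then have "exp \<mu> * (?w \<sigma> * (1 + (B' - B) * ?S \<sigma> - \<mu>)) \<le> exp \<mu> * (?w \<sigma> * exp ((B' - B) * ?S \<sigma> - \<mu>))"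
      using annealed_weight_pos[of d n \<beta> \<sigma>] by (intro mult_left_mono) auto
    also have "\<dots> = annealed_weight d n \<beta> \<sigma> * exp (\<mu> + B * ?S \<sigma> + ((B' - B) * ?S \<sigma> - \<mu>))"
      by (simp only: exp_add mult_ac)
    also have "\<mu> + B * ?S \<sigma> + ((B' - B) * ?S \<sigma> - \<mu>) = B' * ?S \<sigma>" by (simp add: algebra_simps)
    finally show "exp \<mu> * (?w \<sigma> * (1 + (B' - B) * ?S \<sigma> - \<mu>)) \<le> annealed_weight d n \<beta> \<sigma> * exp (B' * ?S \<sigma>)" .
  qed
  finally have "?Z B * exp \<mu> \<le> ?Z B'" by (simp add: annealed_partition_function_weight)
  then have "ln (?Z B * exp \<mu>) \<le> ln (?Z B')" using Z by (subst ln_le_cancel_iff) auto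
  then have "ln (?Z B) + \<mu> \<le> ln (?Z B')" using Z by (simp add: ln_mult)
  then have "(ln (?Z B) + \<mu>) / real n \<le> ln (?Z B') / real n" by (intro divide_right_mono) auto
  then show ?thesis using n by (simp add: finite_pressure_def add_divide_distrib \<mu>_def)
qed

text \<open>
  Markov's inequality for \<open>exp (t * S)\<close>; both signs of \<open>t\<close> are allowed, so this covers both tails.
\<close>

lemma annealed_chernoff:
  assumes n: "n > 0"
  shows "\<P>(\<sigma> in annealed_measure d n \<beta> B. t * (total_spin n \<sigma> / real n) > x) \<le>
    exp (real n * (finite_pressure d n \<beta> (B + t) - finite_pressure d n \<beta> B - x))"
proof -
  let ?Z = "annealed_partition_function d n \<beta>" and ?S = "total_spin n"
  have Z: "?Z B > 0" "?Z (B + t) > 0" by (rule annealed_partition_function_pos)+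
  have "(\<Sum>\<sigma>\<in>{\<sigma> \<in> spin_configs n. t * (?S \<sigma> / real n) > x}. annealed_weight d n \<beta> \<sigma> * exp (B * ?S \<sigma>))
      \<le> (\<Sum>\<sigma>\<in>{\<sigma> \<in> spin_configs n. t * (?S \<sigma> / real n) > x}. exp (- real n * x) * (annealed_weight d n \<beta> \<sigma> * exp ((B + t) * ?S \<sigma>)))"
  proof (intro sum_mono)
    fix \<sigma> assume "\<sigma> \<in> {\<sigma> \<in> spin_configs n. t * (?S \<sigma> / real n) > x}"
    then have "real n * x \<le> t * ?S \<sigma>" using n by (simp add: field_simps)
    then have "annealed_weight d n \<beta> \<sigma> * exp (B * ?S \<sigma>) \<le> annealed_weight d n \<beta> \<sigma> * exp (- real n * x + (B + t) * ?S \<sigma>)"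
      using annealed_weight_pos[of d n \<beta> \<sigma>] by (intro mult_left_mono) (auto simp: algebra_simps)
    also have "\<dots> = exp (- real n * x) * (annealed_weight d n \<beta> \<sigma> * exp ((B + t) * ?S \<sigma>))"
      by (subst exp_add) (rule mult.left_commute)
    finally show "annealed_weight d n \<beta> \<sigma> * exp (B * ?S \<sigma>) \<le> exp (- real n * x) * (annealed_weight d n \<beta> \<sigma> * exp ((B + t) * ?S \<sigma>))" .
  qed
  also have "\<dots> \<le> (\<Sum>\<sigma>\<in>spin_configs n. exp (- real n * x) * (annealed_weight d n \<beta> \<sigma> * exp ((B + t) * ?S \<sigma>)))"
    using annealed_weight_pos by (intro sum_mono2 finite_spin_configs) (auto simp: less_imp_le)
  also have "\<dots> = exp (- real n * x) * ?Z (B + t)"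
    by (simp add: annealed_partition_function_weight sum_distrib_left)
  finally have "\<P>(\<sigma> in annealed_measure d n \<beta> B. t * (?S \<sigma> / real n) > x) \<le> exp (- real n * x) * ?Z (B + t) / ?Z B"
    unfolding measure_annealed_measure using Z by (intro divide_right_mono) auto
  also have "\<dots> = exp (- real n * x + ln (?Z (B + t)) - ln (?Z B))"
    using Z by (simp only: exp_add exp_diff exp_ln)
  also have "- real n * x + ln (?Z (B + t)) - ln (?Z B) =
      real n * (finite_pressure d n \<beta> (B + t) - finite_pressure d n \<beta> B - x)"
    using n by (simp add: finite_pressure_def field_simps)
  finally show ?thesis .
qed

text \<open>
  The slope \<open>m n\<close> lies between the difference quotients of \<open>p n\<close> for negative and for positive increments.
  These converge to difference quotients of \<open>q\<close>, which are close to \<open>D\<close> for small increments.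
\<close>

lemma tangent_limit:
  fixes p :: "nat \<Rightarrow> real \<Rightarrow> real" and m :: "nat \<Rightarrow> real"
  assumes lim: "\<And>x. (\<lambda>n. p n x) \<longlonglongrightarrow> q x"
    and tangent: "\<And>n x. n > 0 \<Longrightarrow> p n x \<ge> p n B + (x - B) * m n"
    and deriv: "(q has_real_derivative D) (at B)"
  shows "m \<longlonglongrightarrow> D"
proof (rule order_tendstoI)
  have slope: "((\<lambda>h. (q (B + h) - q B) / h) \<longlongrightarrow> D) (at 0)"
    using deriv by (simp add: DERIV_def)
  have plim: "(\<lambda>n. (p n (B + h) - p n B) / h) \<longlonglongrightarrow> (q (B + h) - q B) / h" if "h \<noteq> 0" for h
    using that by (intro tendsto_intros lim)
  fix a
  {
    assume a: "a < D"
    have "((\<lambda>h. (q (B + h) - q B) / h) \<longlongrightarrow> D) (at_left 0)"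
      using slope by (rule filterlim_mono) (auto simp: at_le)
    then have "\<forall>\<^sub>F h in at_left 0. a < (q (B + h) - q B) / h \<and> h < 0"
      by (intro eventually_conj order_tendstoD(1)[OF _ a]) (simp_all add: eventually_at_filter)
    then obtain h where h: "a < (q (B + h) - q B) / h" "h < 0"
      using eventually_happens'[OF trivial_limit_at_left_real] by blast
    have "\<forall>\<^sub>F n in sequentially. a < (p n (B + h) - p n B) / h"
      using order_tendstoD(1)[OF plim h(1)] h by simp
    with eventually_gt_at_top[of 0] show "\<forall>\<^sub>F n in sequentially. a < m n"
    proof eventually_elim
      case (elim n)
      have "(p n (B + h) - p n B) / h \<le> m n"
        using tangent[OF elim(1), of "B + h"] h by (simp add: neg_divide_le_eq mult.commute)
      with elim show ?case by simp
    qed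
  }
  {
    assume a: "D < a"
    have "((\<lambda>h. (q (B + h) - q B) / h) \<longlongrightarrow> D) (at_right 0)"
      using slope by (rule filterlim_mono) (auto simp: at_le)
    then have "\<forall>\<^sub>F h in at_right 0. (q (B + h) - q B) / h < a \<and> h > 0"
      by (intro eventually_conj order_tendstoD(2)[OF _ a]) (simp_all add: eventually_at_filter)
    then obtain h where h: "(q (B + h) - q B) / h < a" "h > 0"
      using eventually_happens'[OF trivial_limit_at_right_real] by blast
    have "\<forall>\<^sub>F n in sequentially. (p n (B + h) - p n B) / h < a"
      using order_tendstoD(2)[OF plim h(1)] h by simp
    with eventually_gt_at_top[of 0] show "\<forall>\<^sub>F n in sequentially. m n < a"
    proof eventually_elim
      case (elim n)
      have "m n \<le> (p n (B + h) - p n B) / h"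
        using tangent[OF elim(1), of "B + h"] h by (simp add: pos_le_divide_eq mult.commute)
      with elim show ?case by simp
    qed
  }
qed

text \<open>
  The values \<open>s = 1\<close> and \<open>s = -1\<close> give the two tails. The field is shifted by \<open>s * h\<close> with \<open>h > 0\<close> so small that the difference
  quotient of the pressure exceeds \<open>s * D\<close> by less than half of \<open>\<epsilon>\<close>; the other half, multiplied by \<open>h\<close>, is the
  rate.
\<close>

lemma tail_exponential:
  assumes lim: "\<And>x. (\<lambda>n. finite_pressure d n \<beta> x) \<longlonglongrightarrow> q x"
    and deriv: "(q has_real_derivative D) (at B)"
    and \<epsilon>: "\<epsilon> > 0"
  shows "\<exists>L>0. \<forall>\<^sub>F n in sequentially.
    \<P>(\<sigma> in annealed_measure d n \<beta> B. s * (total_spin n \<sigma> / real n - D) > \<epsilon>) \<le> exp (- real n * L)"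
proof -
  have "((\<lambda>h. q (B + s * h)) has_real_derivative D * s) (at 0)"
    by (rule DERIV_chain2[where f = q]) (use deriv in \<open>auto intro!: derivative_eq_intros\<close>)
  then have "((\<lambda>h. (q (B + s * h) - q B) / h) \<longlongrightarrow> D * s) (at 0)"
    by (simp add: DERIV_def)
  then have "((\<lambda>h. (q (B + s * h) - q B) / h) \<longlongrightarrow> D * s) (at_right 0)"
    by (rule filterlim_mono) (auto simp: at_le)
  then have "\<forall>\<^sub>F h in at_right 0. (q (B + s * h) - q B) / h < D * s + \<epsilon> / 2 \<and> h > 0"
  proof (intro eventually_conj)
    assume slope: "((\<lambda>h. (q (B + s * h) - q B) / h) \<longlongrightarrow> D * s) (at_right 0)"
    have "D * s < D * s + \<epsilon> / 2" using \<epsilon> by simp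
    then show "\<forall>\<^sub>F h in at_right 0. (q (B + s * h) - q B) / h < D * s + \<epsilon> / 2"
      by (rule order_tendstoD(2)[OF slope])
    show "\<forall>\<^sub>F h in at_right 0. h > (0::real)" by (simp add: eventually_at_filter)
  qed
  then obtain h where h: "(q (B + s * h) - q B) / h < D * s + \<epsilon> / 2" "h > 0"
    using eventually_happens'[OF trivial_limit_at_right_real] by blast
  have "(\<lambda>n. finite_pressure d n \<beta> (B + s * h) - finite_pressure d n \<beta> B) \<longlonglongrightarrow> q (B + s * h) - q B"
    by (intro tendsto_intros lim)
  moreover have "q (B + s * h) - q B < h * (D * s + \<epsilon> / 2)"
    using h by (simp add: pos_divide_less_eq mult.commute)
  ultimately have "\<forall>\<^sub>F n in sequentially.
      finite_pressure d n \<beta> (B + s * h) - finite_pressure d n \<beta> B < h * (D * s + \<epsilon> / 2)"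
    by (rule order_tendstoD(2))
  with eventually_gt_at_top[of 0] have "\<forall>\<^sub>F n in sequentially.
    \<P>(\<sigma> in annealed_measure d n \<beta> B. s * (total_spin n \<sigma> / real n - D) > \<epsilon>) \<le> exp (- real n * (h * \<epsilon> / 2))"
  proof eventually_elim
    case (elim n)
    have "s * (y - D) > \<epsilon> \<longleftrightarrow> s * h * y > h * (D * s + \<epsilon>)" for y :: real
    proof -
      have "s * (y - D) > \<epsilon> \<longleftrightarrow> h * \<epsilon> < h * (s * (y - D))" using h by simp
      also have "\<dots> \<longleftrightarrow> s * h * y > h * (D * s + \<epsilon>)" by (simp add: algebra_simps)
      finally show ?thesis .
    qed
    then have "\<P>(\<sigma> in annealed_measure d n \<beta> B. s * (total_spin n \<sigma> / real n - D) > \<epsilon>) \<le>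
        exp (real n * (finite_pressure d n \<beta> (B + s * h) - finite_pressure d n \<beta> B - h * (D * s + \<epsilon>)))"
      using annealed_chernoff[OF elim(1), where t = "s * h" and x = "h * (D * s + \<epsilon>)"] by simp
    also have "\<dots> \<le> exp (real n * (- (h * \<epsilon> / 2)))"
    proof -
      have "finite_pressure d n \<beta> (B + s * h) - finite_pressure d n \<beta> B - h * (D * s + \<epsilon>) \<le> - (h * \<epsilon> / 2)"
        using elim(2) by (simp add: algebra_simps)
      then show ?thesis unfolding exp_le_cancel_iff by (intro mult_left_mono) auto
    qed
    finally show ?case by simp
  qed
  then show ?thesis using h \<epsilon> by (intro exI[of _ "h * \<epsilon> / 2"]) auto
qed

lemma concentration:
  assumes lim: "\<And>x. (\<lambda>n. finite_pressure d n \<beta> x) \<longlonglongrightarrow> q x"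
    and deriv: "(q has_real_derivative D) (at B)"
    and \<epsilon>: "\<epsilon> > 0"
  shows "\<exists>L>0. \<forall>\<^sub>F n in sequentially.
    \<P>(\<sigma> in annealed_measure d n \<beta> B. \<bar>total_spin n \<sigma> / real n - D\<bar> > \<epsilon>) \<le> exp (- real n * L)"
proof -
  let ?P = "\<lambda>n Q. \<P>(\<sigma> in annealed_measure d n \<beta> B. Q (total_spin n \<sigma> / real n - D))"
  obtain L1 where L1: "L1 > 0" "\<forall>\<^sub>F n in sequentially. ?P n (\<lambda>y. 1 * y > \<epsilon>) \<le> exp (- real n * L1)"
    using tail_exponential[OF lim deriv \<epsilon>, where s = 1] by blast
  obtain L2 where L2: "L2 > 0" "\<forall>\<^sub>F n in sequentially. ?P n (\<lambda>y. (- 1) * y > \<epsilon>) \<le> exp (- real n * L2)"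
    using tail_exponential[OF lim deriv \<epsilon>, where s = "- 1"] by blast
  define L where "L = min L1 L2"
  have L: "L > 0" "L \<le> L1" "L \<le> L2" using L1 L2 by (auto simp: L_def)
  \<comment> \<open>Half of the rate absorbs the factor \<open>2\<close> from the union of the two tails.\<close>
  have "\<forall>\<^sub>F n in sequentially. ln 2 / (L / 2) < real n"
    using filterlim_real_sequentially by (simp add: filterlim_at_top_dense)
  with L1(2) L2(2) have "\<forall>\<^sub>F n in sequentially. ?P n (\<lambda>y. \<bar>y\<bar> > \<epsilon>) \<le> exp (- real n * (L / 2))"
  proof eventually_elim
    case (elim n)
    interpret prob_space "annealed_measure d n \<beta> B" by (rule prob_space_annealed_measure)
    have sets: "A \<in> sets (annealed_measure d n \<beta> B)" if "A \<subseteq> spin_configs n" for A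
      using that by (simp add: annealed_measure_def sets_point_measure)
    have "?P n (\<lambda>y. \<bar>y\<bar> > \<epsilon>) \<le> measure (annealed_measure d n \<beta> B)
        ({\<sigma> \<in> space (annealed_measure d n \<beta> B). 1 * (total_spin n \<sigma> / real n - D) > \<epsilon>} \<union>
         {\<sigma> \<in> space (annealed_measure d n \<beta> B). (- 1) * (total_spin n \<sigma> / real n - D) > \<epsilon>})"
      by (intro finite_measure_mono sets) (auto simp: space_annealed_measure)
    also have "\<dots> \<le> ?P n (\<lambda>y. 1 * y > \<epsilon>) + ?P n (\<lambda>y. (- 1) * y > \<epsilon>)"
      by (intro measure_Un_le sets) (auto simp: space_annealed_measure)
    also have "\<dots> \<le> exp (- real n * L1) + exp (- real n * L2)" using elim by (intro add_mono)
    also have "\<dots> \<le> exp (- real n * L) + exp (- real n * L)"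
      using L by (intro add_mono) (auto intro: mult_left_mono)
    also have "\<dots> = exp (ln 2 + - real n * L)" by (subst exp_add) simp
    also have "\<dots> \<le> exp (- real n * (L / 2))"
      using elim(3) L by (simp add: field_simps)
    finally show ?case .
  qed
  then show ?thesis using L by (intro exI[of _ "L / 2"]) auto
qed

section \<open>The pressure and the spontaneous magnetization\<close>

context
  fixes d :: nat and \<beta> :: real
  assumes d: "d \<ge> 2" and \<beta>: "\<beta> \<ge> 0"
begin

lemma finite_pressure_tendsto: "(\<lambda>n. finite_pressure d n \<beta> x) \<longlonglongrightarrow> ln (growth_rate d \<beta> x)"
  unfolding finite_pressure_def using pressure_limit \<beta> d by simp

lemma pressure_eq: "pressure d \<beta> = (\<lambda>B. ln (growth_rate d \<beta> B))"
  unfolding pressure_def using limI[OF finite_pressure_tendsto[unfolded finite_pressure_def]] by blast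

lemma finite_pressure_tendsto_pressure: "(\<lambda>n. finite_pressure d n \<beta> x) \<longlonglongrightarrow> pressure d \<beta> x"
  using finite_pressure_tendsto by (simp add: pressure_eq)

lemma finite_magnetization_tendsto:
  assumes "(pressure d \<beta> has_real_derivative D) (at B)"
  shows "(\<lambda>n. finite_magnetization d n \<beta> B) \<longlonglongrightarrow> D"
  by (rule tangent_limit[OF finite_pressure_tendsto_pressure finite_pressure_tangent assms])

lemma magnetization_eq:
  assumes "(pressure d \<beta> has_real_derivative D) (at B)"
  shows "magnetization d \<beta> B = D"
  unfolding magnetization_def by (rule limI[OF finite_magnetization_tendsto[OF assms]])

lemma pressure_has_derivative_nonzero_field:
  assumes "B \<noteq> 0"
  shows "(pressure d \<beta> has_real_derivative magnetization d \<beta> B) (at B)"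
  using log_growth_rate_differentiable[OF \<beta> d assms] magnetization_eq by (auto simp: pressure_eq)

lemma pressure_tangent:
  assumes "B \<noteq> 0"
  shows "pressure d \<beta> x \<ge> pressure d \<beta> B + (x - B) * magnetization d \<beta> B"
proof (rule LIMSEQ_le)
  show "(\<lambda>n. finite_pressure d n \<beta> B + (x - B) * finite_magnetization d n \<beta> B)
      \<longlonglongrightarrow> pressure d \<beta> B + (x - B) * magnetization d \<beta> B"
    by (intro tendsto_intros finite_pressure_tendsto_pressure finite_magnetization_tendsto
        pressure_has_derivative_nonzero_field assms)
  show "(\<lambda>n. finite_pressure d n \<beta> x) \<longlonglongrightarrow> pressure d \<beta> x" by (rule finite_pressure_tendsto_pressure)
  show "\<exists>N. \<forall>n\<ge>N. finite_pressure d n \<beta> B + (x - B) * finite_magnetization d n \<beta> B \<le> finite_pressure d n \<beta> x"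
    using finite_pressure_tangent[of _ d \<beta> B x] by (intro exI[of _ 1]) auto
qed

lemma pressure_minus: "pressure d \<beta> (- B) = pressure d \<beta> B"
  by (simp add: pressure_eq growth_rate_minus)

lemma magnetization_nonneg:
  assumes "B > 0" shows "magnetization d \<beta> B \<ge> 0"
  using pressure_tangent[of B "- B"] assms by (simp add: pressure_minus zero_le_mult_iff)

lemma magnetization_mono:
  assumes "0 < B" "B \<le> C" shows "magnetization d \<beta> B \<le> magnetization d \<beta> C"
proof (cases "B = C")
  case False
  have "(C - B) * magnetization d \<beta> B \<le> (C - B) * magnetization d \<beta> C"
    using pressure_tangent[of B C] pressure_tangent[of C B] assms by (simp add: algebra_simps)
  then show ?thesis using False assms by simp
qed simp

text \<open>
  The magnetization is nonnegative and nondecreasing for positive fields, because it is the slope of a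
  convex even function.
\<close>

lemma spontaneous_magnetization_exists:
  "\<exists>m\<ge>0. (magnetization d \<beta> \<longlongrightarrow> m) (at_right 0)"
proof -
  define m where "m = (INF B\<in>{0<..}. magnetization d \<beta> B)"
  have bdd: "bdd_below (magnetization d \<beta> ` {0<..})"
    using magnetization_nonneg by (intro bdd_belowI[of _ 0]) auto
  have "(magnetization d \<beta> \<longlongrightarrow> m) (at_right 0)"
  proof (rule order_tendstoI)
    fix a assume a: "a < m"
    have m_le: "m \<le> magnetization d \<beta> B" if "B > 0" for B
      unfolding m_def using that by (intro cINF_lower bdd) auto
    show "\<forall>\<^sub>F B in at_right 0. a < magnetization d \<beta> B"
      using eventually_at_right_less[of 0] by eventually_elim (rule less_le_trans[OF a m_le])
  next
    fix a assume "m < a"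
    then obtain C where C: "C > 0" "magnetization d \<beta> C < a"
      using cINF_less_iff[OF _ bdd] by (auto simp: m_def)
    have "\<forall>\<^sub>F B in at_right 0. 0 < B \<and> B < C"
      using C(1) eventually_at_right by blast
    then show "\<forall>\<^sub>F B in at_right 0. magnetization d \<beta> B < a"
    proof eventually_elim
      case (elim B)
      then have "magnetization d \<beta> B \<le> magnetization d \<beta> C" by (intro magnetization_mono) auto
      then show ?case using C(2) by simp
    qed
  qed
  moreover have "m \<ge> 0" unfolding m_def by (intro cINF_greatest magnetization_nonneg) auto
  ultimately show ?thesis by blast
qed

text \<open>
  The limit exists, so if it were positive, \<open>\<beta>\<close> would be an element of the set whose infimum defines
  the critical inverse temperature.
\<close>

lemma no_spontaneous_magnetization:
  assumes "\<beta> > 0" "ereal \<beta> < critical_beta d"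
  shows "(magnetization d \<beta> \<longlongrightarrow> 0) (at_right 0)"
proof -
  obtain m where m: "m \<ge> 0" "(magnetization d \<beta> \<longlongrightarrow> m) (at_right 0)"
    using spontaneous_magnetization_exists by blast
  have "\<not> m > 0"
  proof
    assume "m > 0"
    then have "critical_beta d \<le> ereal \<beta>"
      unfolding critical_beta_def using assms(1) m(2) by (intro INF_lower) auto
    then show False using assms(2) by simp
  qed
  then show ?thesis using m by simp
qed

text \<open>
  The pressure is even and minimal at \<open>0\<close>, and the tangent at \<open>h > 0\<close> bounds its difference quotient by
  the magnetization at \<open>h\<close>, which tends to \<open>0\<close>.
\<close>

lemma pressure_has_derivative_zero_field:
  assumes "\<beta> > 0" "ereal \<beta> < critical_beta d"
  shows "(pressure d \<beta> has_real_derivative 0) (at 0)"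
proof -
  have lower: "pressure d \<beta> 0 \<le> pressure d \<beta> h" for h
    using growth_rate_ge_zero_field growth_rate_pos by (simp add: pressure_eq)
  have upper: "pressure d \<beta> h - pressure d \<beta> 0 \<le> h * magnetization d \<beta> h" if "h > 0" for h
    using pressure_tangent[of h 0] that by simp
  have abs: "filterlim (\<lambda>h::real. \<bar>h\<bar>) (at_right 0) (at 0)"
    by (auto simp: filterlim_at eventually_at_filter intro!: tendsto_eq_intros)
  have "((\<lambda>h. (pressure d \<beta> h - pressure d \<beta> 0) / h) \<longlongrightarrow> 0) (at 0)"
  proof (rule Lim_null_comparison)
    show "((\<lambda>h. magnetization d \<beta> \<bar>h\<bar>) \<longlongrightarrow> 0) (at 0)"
      by (rule filterlim_compose[OF no_spontaneous_magnetization[OF assms] abs])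
    have "norm ((pressure d \<beta> h - pressure d \<beta> 0) / h) \<le> magnetization d \<beta> \<bar>h\<bar>" if "h \<noteq> 0" for h
    proof -
      have "pressure d \<beta> h = pressure d \<beta> \<bar>h\<bar>" by (simp add: abs_if pressure_minus)
      then have "\<bar>pressure d \<beta> h - pressure d \<beta> 0\<bar> \<le> \<bar>h\<bar> * magnetization d \<beta> \<bar>h\<bar>"
        using lower[of h] upper[of "\<bar>h\<bar>"] that by simp
      then show ?thesis using that by (simp add: pos_divide_le_eq mult.commute)
    qed
    then show "\<forall>\<^sub>F h in at 0. norm ((pressure d \<beta> h - pressure d \<beta> 0) / h) \<le> magnetization d \<beta> \<bar>h\<bar>"
      by (simp add: eventually_at_filter)
  qed
  then show ?thesis by (simp add: DERIV_def)
qed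

end

section \<open>Exponential concentration of the magnetization\<close>

theorem theorem1p2:
  fixes d :: nat and \<beta> B :: real
  assumes "d \<ge> 2" and "(\<beta>, B) \<in> uniqueness_region d"
  shows "(\<lambda>n. finite_magnetization d n \<beta> B) \<longlonglongrightarrow> magnetization d \<beta> B
    \<and> (pressure d \<beta> has_real_derivative magnetization d \<beta> B) (at B)
    \<and> (\<forall>\<epsilon>>0. \<exists>L>0. \<forall>\<^sub>F n in sequentially.
          \<P>(\<sigma> in annealed_measure d n \<beta> B.
             \<bar>total_spin n \<sigma> / real n - magnetization d \<beta> B\<bar> > \<epsilon>) \<le> exp (- real n * L))"
proof -
  have \<beta>: "\<beta> \<ge> 0" using assms(2) by (auto simp: uniqueness_region_def)
  have deriv: "(pressure d \<beta> has_real_derivative magnetization d \<beta> B) (at B)"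
  proof (cases "B = 0")
    case True
    then have "(pressure d \<beta> has_real_derivative 0) (at 0)"
      using assms pressure_has_derivative_zero_field[OF assms(1) \<beta>]
      by (auto simp: uniqueness_region_def)
    then show ?thesis using magnetization_eq[OF assms(1) \<beta>] True by simp
  next
    case False
    then show ?thesis by (rule pressure_has_derivative_nonzero_field[OF assms(1) \<beta>])
  qed
  then show ?thesis
    using finite_magnetization_tendsto[OF assms(1) \<beta> deriv]
      concentration[OF finite_pressure_tendsto_pressure[OF assms(1) \<beta>] deriv] by blast
qed

end
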